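(* Let $c_{10},c_{11},c_{12}$ be real constants. The rotational hypersurface $$\Gamma^{t}(s,t,w)=\left(\pm\int_{1}^{s}\frac{\sqrt{2\left(6c_{10}c_{11}x^{3}+c_{10}\right)}}{\sqrt{12c_{10}c_{11}x^{3}+3x+2c_{10}}}\,dx+c_{12},\ -s\cos t\sin w,\ -s\sin t,\ s\cos t\cos w\right)$$ has first kind $L_1$-pointwise 1-type Gauss map, i.e. $L_1N^{t}=\mathfrak m N^{t}$, in $\mathbb E_1^4$, where $$\mathfrak m=\frac{c_{10}^{2}\sqrt2\,\left(1+12c_{11}s^{3}\left(1+12c_{11}s^{3}\right)\right)}{(-s)^{9/2}\sqrt{3c_{10}\left(1+6c_{11}s^{3}\right)}}$$ and $$L_1N^{t}=\frac{2c_{10}^{2}\left(1+12s^{3}c_{11}\left(1+12c_{11}s^{3}\right)\right)}{3s^{5}}\left(\frac{\sqrt{6s+4c_{10}+24c_{10}c_{11}s^{3}}}{2\sqrt{c_{10}\left(1+6c_{11}s^{3}\right)}},\ \cos t\sin w,\ \sin t,\ -\cos t\cos w\right).$$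
   Context: $\mathbb E_1^4$ is $\mathbb R^4$ with the Lorentzian metric $\langle\,,\rangle=-dx_1^2+dx_2^2+dx_3^2+dx_4^2$. The hypersurface is of the form $\Gamma^{t}(s,t,w)=(f(s),\,-s\cos t\sin w,\,-s\sin t,\,s\cos t\cos w)$, $s\in\mathbb R\setminus\{0\}$, $0\le t,w\le2\pi$, obtained by rotating the profile curve $(f(s),0,0,s)$ about the timelike axis $(1,0,0,0)$, where $f'\neq0$ and $'=d/ds$. Its Gauss map is $N^{t}=\frac{1}{\sqrt{f'^2-1}}\left(1,\ -f'\cos t\sin w,\ -f'\sin t,\ f'\cos t\cos w\right)$, with $\langle N^{t},N^{t}\rangle=1$. For an oriented hypersurface $M$ of $\mathbb E_1^4$ with nondegenerate induced metric $g$, unit normal field (Gauss map) $N$, $\varepsilon=\langle N,N\rangle=\pm1$, shape operator $S=-dN$ and principal curvatures $\kappa_1,\kappa_2,\kappa_3$, put $a_1=-(\kappa_1+\kappa_2+\kappa_3)$, $a_2=\kappa_1\kappa_2+\kappa_1\kappa_3+\kappa_2\kappa_3$, $a_3=-\kappa_1\kappa_2\kappa_3$. The operator $L_k$ is $L_k(\varphi)=\mathrm{tr}(P_k\circ\nabla^2\varphi)$ for $\varphi\in C^\infty(M)$, where $P_k$ is the $k$-th Newton transformation associated with $S$ (that is, $P_0=I$, $P_k=a_kI+S\circ P_{k-1}$) and $\nabla^2\varphi$ is the Hessian operator of $\varphi$; $L_k$ acts componentwise on $\mathbb R^4$-valued functions. With $n=3$, $\binom{n}{k}H_k=(-\varepsilon)^ka_k$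 and $C_k=\binom{n}{k+1}(-\varepsilon)^k$, one has $L_kN=-\varepsilon C_k\big(\nabla H_{k+1}+(nH_1H_{k+1}-(n-k-1)H_{k+2})N\big)$, where $\nabla$ is the gradient of $g$. $M$ has first kind $L_k$-pointwise 1-type Gauss map if $L_kN=\mathfrak mN$ for a non-zero smooth function $\mathfrak m$ on $M$.
   Formalization: The printed m fits only the upper sign of ± and the printed L_1N^t only the lower; the formal version multiplies m by the sign and the first component of L_1N^t by minus the sign. Formulas are read over the reals (s<0, integrand real on [s,1]) and cos t ≠ 0, where the map is an immersion. *)

theory Defs
  imports "HOL-Analysis.Analysis"
begin

definition mink :: "real^4 \<Rightarrow> real^4 \<Rightarrow> real" where
  "mink x y = - x$1 * y$1 + x$2 * y$2 + x$3 * y$3 + x$4 * y$4"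

text \<open>
  Hypersurfaces are given by parametrizations on an open set of
  \<open>real^3\<close>. Tensors are represented by their components with respect to the
  coordinate frame; for an operator \<open>A\<close>, the entry \<open>A $ i $ j\<close> is the \<open>i\<close>-th
  component of the image of the \<open>j\<close>-th coordinate vector.
\<close>

definition pd :: "3 \<Rightarrow> (real^3 \<Rightarrow> 'b::real_normed_vector) \<Rightarrow> real^3 \<Rightarrow> 'b" where
  "pd i F p = frechet_derivative F (at p) (axis i 1)"

text \<open>
  Smoothness: on an open set, all iterated partial derivatives exist and are
  differentiable.
\<close>
definition smooth_on :: "(real^3) set \<Rightarrow> (real^3 \<Rightarrow> 'b::real_normed_vector) \<Rightarrow> bool" where
  "smooth_on U F \<longleftrightarrow> open U \<and> (\<forall>is. \<forall>p\<in>U. fold pd is F differentiable (at p))"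

definition induced_metric :: "(real^3 \<Rightarrow> real^4) \<Rightarrow> real^3 \<Rightarrow> real^3^3" where
  "induced_metric X p = (\<chi> i j. mink (pd i X p) (pd j X p))"

definition oriented_hypersurface ::
  "(real^3) set \<Rightarrow> (real^3 \<Rightarrow> real^4) \<Rightarrow> (real^3 \<Rightarrow> real^4) \<Rightarrow> real \<Rightarrow> bool" where
  "oriented_hypersurface U X N \<epsilon> \<longleftrightarrow>
     open U \<and> smooth_on U X \<and> smooth_on U N \<and> (\<epsilon> = 1 \<or> \<epsilon> = -1) \<and>
     (\<forall>p\<in>U. det (induced_metric X p) \<noteq> 0 \<and> mink (N p) (N p) = \<epsilon> \<and>
            (\<forall>i. mink (N p) (pd i X p) = 0))"

definition christoffel :: "(real^3 \<Rightarrow> real^4) \<Rightarrow> real^3 \<Rightarrow> 3 \<Rightarrow> 3 \<Rightarrow> 3 \<Rightarrow> real" where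
  "christoffel X p k i j =
     (\<Sum>l\<in>UNIV. matrix_inv (induced_metric X p) $ k $ l *
        (pd i (\<lambda>q. induced_metric X q $ j $ l) p + pd j (\<lambda>q. induced_metric X q $ i $ l) p
         - pd l (\<lambda>q. induced_metric X q $ i $ j) p)) / 2"

definition gradient :: "(real^3 \<Rightarrow> real^4) \<Rightarrow> (real^3 \<Rightarrow> real) \<Rightarrow> real^3 \<Rightarrow> real^3" where
  "gradient X \<phi> p = matrix_inv (induced_metric X p) *v (\<chi> j. pd j \<phi> p)"

text \<open>The Hessian operator sends \<open>V\<close> to the covariant derivative of the gradient along \<open>V\<close>.\<close>
definition hessian_operator :: "(real^3 \<Rightarrow> real^4) \<Rightarrow> (real^3 \<Rightarrow> real) \<Rightarrow> real^3 \<Rightarrow> real^3^3" where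
  "hessian_operator X \<phi> p =
     (\<chi> i j. pd j (\<lambda>q. gradient X \<phi> q $ i) p
            + (\<Sum>l\<in>UNIV. christoffel X p i j l * gradient X \<phi> p $ l))"

text \<open>The shape operator \<open>S = - dN\<close>.\<close>
definition shape_operator ::
  "(real^3 \<Rightarrow> real^4) \<Rightarrow> (real^3 \<Rightarrow> real^4) \<Rightarrow> real^3 \<Rightarrow> real^3^3" where
  "shape_operator X N p =
     (THE S. \<forall>j. - pd j N p = (\<Sum>i\<in>UNIV. S $ i $ j *\<^sub>R pd i X p))"

text \<open>
  The principal curvatures are the eigenvalues of the shape operator with algebraic
  multiplicity. They are taken in the complex numbers, since an operator that is
  self-adjoint for an indefinite metric may have non-real eigenvalues; their symmetric
  functions are real and do not depend on the chosen ordering.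
\<close>
definition principal_curvatures :: "real^3^3 \<Rightarrow> complex^3" where
  "principal_curvatures S =
     (SOME \<kappa>. \<forall>z. det (mat z - (\<chi> i j. complex_of_real (S $ i $ j))) =
                 (z - \<kappa>$1) * (z - \<kappa>$2) * (z - \<kappa>$3))"

definition a_coeff :: "real^3^3 \<Rightarrow> nat \<Rightarrow> real" where
  "a_coeff S k =
     (let \<kappa> = principal_curvatures S in
      if k = 0 then 1
      else if k = 1 then Re (- (\<kappa>$1 + \<kappa>$2 + \<kappa>$3))
      else if k = 2 then Re (\<kappa>$1 * \<kappa>$2 + \<kappa>$1 * \<kappa>$3 + \<kappa>$2 * \<kappa>$3)
      else if k = 3 then Re (- (\<kappa>$1 * \<kappa>$2 * \<kappa>$3))
      else 0)"

primrec newton_transformation :: "real^3^3 \<Rightarrow> nat \<Rightarrow> real^3^3" where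
  "newton_transformation S 0 = mat 1"
| "newton_transformation S (Suc k) =
     a_coeff S (Suc k) *\<^sub>R mat 1 + S ** newton_transformation S k"

definition L_op ::
  "nat \<Rightarrow> (real^3 \<Rightarrow> real^4) \<Rightarrow> (real^3 \<Rightarrow> real^4) \<Rightarrow> (real^3 \<Rightarrow> real) \<Rightarrow> real^3 \<Rightarrow> real" where
  "L_op k X N \<phi> p =
     trace (newton_transformation (shape_operator X N p) k ** hessian_operator X \<phi> p)"

definition L_vec ::
  "nat \<Rightarrow> (real^3 \<Rightarrow> real^4) \<Rightarrow> (real^3 \<Rightarrow> real^4) \<Rightarrow> (real^3 \<Rightarrow> real^4) \<Rightarrow> real^3 \<Rightarrow> real^4" where
  "L_vec k X N \<Phi> p = (\<chi> c. L_op k X N (\<lambda>q. \<Phi> q $ c) p)"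

definition first_kind_pointwise_1_type ::
  "nat \<Rightarrow> (real^3) set \<Rightarrow> (real^3 \<Rightarrow> real^4) \<Rightarrow> (real^3 \<Rightarrow> real^4) \<Rightarrow> bool" where
  "first_kind_pointwise_1_type k U X N \<longleftrightarrow>
     (\<exists>m. smooth_on U m \<and> (\<forall>p\<in>U. m p \<noteq> 0) \<and> (\<forall>p\<in>U. L_vec k X N N p = m p *\<^sub>R N p))"

text \<open>
  Rotational hypersurfaces about the timelike axis, in the coordinates
  \<open>(s, t, w) = (p$1, p$2, p$3)\<close>.
\<close>
definition rot_hypersurface :: "(real \<Rightarrow> real) \<Rightarrow> real^3 \<Rightarrow> real^4" where
  "rot_hypersurface f p =
     (let s = p$1; t = p$2; w = p$3 in
      vector [f s, - s * cos t * sin w, - s * sin t, s * cos t * cos w])"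

definition rot_gauss_map :: "(real \<Rightarrow> real) \<Rightarrow> real^3 \<Rightarrow> real^4" where
  "rot_gauss_map f p =
     (let t = p$2; w = p$3; f' = deriv f (p$1) in
      (1 / sqrt (f'\<^sup>2 - 1)) *\<^sub>R
        vector [1, - f' * cos t * sin w, - f' * sin t, f' * cos t * cos w])"

text \<open>
  The interval integral is oriented. The parameter \<open>\<sigma>\<close> is the sign in front of it.
\<close>
definition profile :: "real \<Rightarrow> real \<Rightarrow> real \<Rightarrow> real \<Rightarrow> real \<Rightarrow> real" where
  "profile \<sigma> c10 c11 c12 s =
     \<sigma> * (LBINT x=ereal 1..ereal s.
            sqrt (2 * (6 * c10 * c11 * x^3 + c10)) / sqrt (12 * c10 * c11 * x^3 + 3 * x + 2 * c10))
     + c12"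

text \<open>
  The negative \<open>s\<close> for which the integrand of the profile function is a well-defined
  real number on the whole interval of integration. Negativity of \<open>s\<close> is what makes
  \<open>f'\<^sup>2 > 1\<close> there.
\<close>
definition profile_domain :: "real \<Rightarrow> real \<Rightarrow> real set" where
  "profile_domain c10 c11 =
     {s. s < 0 \<and> (\<forall>x\<in>{s..1}. 0 \<le> 2 * (6 * c10 * c11 * x^3 + c10) \<and>
                              0 < 12 * c10 * c11 * x^3 + 3 * x + 2 * c10)}"

text \<open>The points with \<open>cos t = 0\<close> are excluded: there the parametrization is not an immersion.\<close>
definition param_domain :: "real \<Rightarrow> real \<Rightarrow> (real^3) set" where
  "param_domain c10 c11 = {p. p$1 \<in> profile_domain c10 c11 \<and> cos (p$2) \<noteq> 0}"

end

theory Submission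
  imports Defs
begin

text \<open>
  In the coordinates \<open>(s, t, w)\<close> the metric and the shape operator are diagonal. With
  \<open>h = f' / sqrt (f'\<^sup>2 - 1)\<close> the principal curvatures are \<open>- h'\<close>, \<open>- h / s\<close>, \<open>- h / s\<close>, so
  \<open>a\<^sub>2 = (s h\<^sup>2)' / s\<^sup>2\<close>. For the given profile
  \<open>h\<^sup>2 = - 2 c\<^sub>1\<^sub>0 (6 c\<^sub>1\<^sub>1 s\<^sup>3 + 1) / (3 s)\<close>, hence \<open>a\<^sub>2 = - 12 c\<^sub>1\<^sub>0 c\<^sub>1\<^sub>1\<close> is constant, the
  gradient term of \<open>L\<^sub>1 N\<close> vanishes, and the remaining factor is
  \<open>- 2 h / s (h\<^sup>2 / s\<^sup>2 + h'\<^sup>2 + h h' / s)\<close>, which is a nonzero rational function of \<open>s\<close> divided by \<open>h\<close>.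
\<close>

section \<open>Partial derivatives\<close>

lemma vector_4 [simp]:
  "(vector [a, b, c, d] :: 'a::zero^4) $ 1 = a"
  "(vector [a, b, c, d] :: 'a::zero^4) $ 2 = b"
  "(vector [a, b, c, d] :: 'a::zero^4) $ 3 = c"
  "(vector [a, b, c, d] :: 'a::zero^4) $ 4 = d"
  unfolding vector_def by simp_all

lemma has_derivative_vec_componentwise:
  fixes F :: "'a::real_normed_vector \<Rightarrow> real^'n"
  shows "(F has_derivative F') (at p) \<longleftrightarrow>
    (\<forall>i. ((\<lambda>q. F q $ i) has_derivative (\<lambda>v. F' v $ i)) (at p))"
  unfolding has_derivative_componentwise_within[of F]
  by (auto simp: Basis_vec_def inner_axis)

lemma has_derivative_nth: "((\<lambda>q::real^'n. q $ i) has_derivative (\<lambda>v. v $ i)) (at p)"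
  by (rule bounded_linear_imp_has_derivative[OF bounded_linear_vec_nth])

lemma has_derivative_comp_nth:
  fixes p :: "real^'n"
  assumes "(g has_real_derivative g') (at (p $ i))"
  shows "((\<lambda>q. g (q $ i)) has_derivative (\<lambda>v. g' * v $ i)) (at p)"
  using DERIV_compose_FDERIV[OF assms bounded_linear_imp_has_derivative[OF bounded_linear_vec_nth]]
  by (simp add: mult.commute)

lemma pd_eqI: "(F has_derivative F') (at p) \<Longrightarrow> pd i F p = F' (axis i 1)"
  unfolding pd_def using frechet_derivative_at by metis

lemma pd_nth:
  fixes F :: "real^3 \<Rightarrow> real^'n"
  assumes "F differentiable (at p)"
  shows "pd i F p $ c = pd i (\<lambda>q. F q $ c) p"
proof -
  obtain F' where F': "(F has_derivative F') (at p)"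
    using assms unfolding differentiable_def by blast
  then have "((\<lambda>q. F q $ c) has_derivative (\<lambda>v. F' v $ c)) (at p)"
    by (simp add: has_derivative_vec_componentwise)
  then show ?thesis using F' by (simp add: pd_eqI)
qed

lemma has_derivative_cong_open:
  assumes "open U" "p \<in> U" "\<And>q. q \<in> U \<Longrightarrow> F q = G q"
  shows "(F has_derivative F') (at p) \<longleftrightarrow> (G has_derivative F') (at p)"
  using assms by (metis has_derivative_transform_within_open)

text \<open>\<open>frechet_derivative\<close> is a choice among the maps satisfying
  \<open>has_derivative\<close>, and that predicate depends only on the germ at \<open>p\<close>. So
  the equality also covers points where the derivative does not exist.\<close>

lemma pd_cong_open:
  assumes "open U" "p \<in> U" "\<And>q. q \<in> U \<Longrightarrow> F q = G q"
  shows "pd i F p = pd i G p"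
  unfolding pd_def frechet_derivative_def using has_derivative_cong_open[OF assms] by simp

lemma differentiable_cong_open:
  assumes "open U" "p \<in> U" "\<And>q. q \<in> U \<Longrightarrow> F q = G q"
  shows "F differentiable (at p) \<longleftrightarrow> G differentiable (at p)"
  unfolding differentiable_def using has_derivative_cong_open[OF assms] by simp

section \<open>Smoothness\<close>

text \<open>Nothing is known about partial derivatives outside \<open>U\<close>, so the invariant
  carried along the index list is agreement on \<open>U\<close> with some member of
  \<open>P\<close>. Openness of \<open>U\<close> lets this agreement survive
  differentiation.\<close>

lemma smooth_on_coinduct:
  assumes "open U" "P F"
    and step: "\<And>F. P F \<Longrightarrow> (\<forall>p\<in>U. F differentiable (at p)) \<and>
                 (\<forall>i. \<exists>G. P G \<and> (\<forall>p\<in>U. pd i F p = G p))"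
  shows "smooth_on U F"
proof -
  have "\<forall>p\<in>U. fold pd is F' differentiable (at p)"
    if "\<exists>G. P G \<and> (\<forall>p\<in>U. F' p = G p)" for "is" F'
    using that
  proof (induction "is" arbitrary: F')
    case Nil
    then obtain G where "P G" "\<And>p. p \<in> U \<Longrightarrow> F' p = G p" by blast
    then show ?case
      using step[of G] differentiable_cong_open[OF assms(1), of _ F' G] by simp
  next
    case (Cons i "is")
    then obtain G where G: "P G" "\<And>p. p \<in> U \<Longrightarrow> F' p = G p" by blast
    obtain H where H: "P H" "\<forall>p\<in>U. pd i G p = H p"
      using step[OF G(1)] by blast
    have "\<forall>p\<in>U. pd i F' p = H p"
      using H(2) pd_cong_open[OF assms(1) _ G(2)] by simp
    then have "\<exists>G. P G \<and> (\<forall>p\<in>U. pd i F' p = G p)"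
      using H(1) by blast
    from Cons.IH[OF this] show ?case by simp
  qed
  then show ?thesis
    unfolding smooth_on_def using assms(1,2) by blast
qed

text \<open>A class of functions that is closed under partial derivatives for syntactic reasons.
  The rule \<open>prim\<close> admits antiderivatives, such as the profile function.\<close>
inductive elementary :: "(real^3) set \<Rightarrow> (real^3 \<Rightarrow> real) \<Rightarrow> bool" for U where
  const: "elementary U (\<lambda>p. c)"
| coord: "elementary U (\<lambda>p. p $ i)"
| add: "elementary U F \<Longrightarrow> elementary U G \<Longrightarrow> elementary U (\<lambda>p. F p + G p)"
| mult: "elementary U F \<Longrightarrow> elementary U G \<Longrightarrow> elementary U (\<lambda>p. F p * G p)"
| sin: "elementary U F \<Longrightarrow> elementary U (\<lambda>p. sin (F p))"
| cos: "elementary U F \<Longrightarrow> elementary U (\<lambda>p. cos (F p))"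
| inverse: "elementary U F \<Longrightarrow> (\<And>p. p \<in> U \<Longrightarrow> F p \<noteq> 0) \<Longrightarrow> elementary U (\<lambda>p. inverse (F p))"
| sqrt: "elementary U F \<Longrightarrow> (\<And>p. p \<in> U \<Longrightarrow> F p > 0) \<Longrightarrow> elementary U (\<lambda>p. sqrt (F p))"
| prim: "elementary U (\<lambda>p. g (p $ i)) \<Longrightarrow>
    (\<And>p. p \<in> U \<Longrightarrow> (f has_real_derivative g (p $ i)) (at (p $ i))) \<Longrightarrow>
    elementary U (\<lambda>p. f (p $ i))"
| cong: "elementary U F \<Longrightarrow> (\<And>p. p \<in> U \<Longrightarrow> G p = F p) \<Longrightarrow> elementary U G"

lemma elementary_minus: "elementary U F \<Longrightarrow> elementary U (\<lambda>p. - F p)"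
  using elementary.mult[OF elementary.const[of U "-1"]] by simp

lemma elementary_half: "elementary U F \<Longrightarrow> elementary U (\<lambda>p. F p / 2)"
  using elementary.mult[OF _ elementary.const[of U "1/2"]] by simp

lemma elementary_divide:
  "elementary U F \<Longrightarrow> elementary U G \<Longrightarrow> (\<And>p. p \<in> U \<Longrightarrow> G p \<noteq> 0) \<Longrightarrow> elementary U (\<lambda>p. F p / G p)"
  using elementary.mult[OF _ elementary.inverse] by (simp add: divide_inverse)

lemma elementary_power: "elementary U F \<Longrightarrow> elementary U (\<lambda>p. F p ^ k)"
  by (induction k) (simp_all add: elementary.const elementary.mult)

text \<open>Each rule of \<open>elementary\<close> has a differentiation rule whose result is again
  built from the rules. Working with the total derivative lets the product and chain rules apply
  directly; evaluating at axis vectors gives the partial derivatives.\<close>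

lemma elementary_has_derivative:
  assumes "elementary U F" "open U"
  shows "\<exists>F'. (\<forall>p\<in>U. (F has_derivative F' p) (at p)) \<and>
              (\<forall>i. elementary U (\<lambda>p. F' p (axis i 1)))"
  using assms(1)
proof induction
  case (const c)
  show ?case
    by (rule exI[of _ "\<lambda>p v. 0"]) (auto intro: elementary.const)
next
  case (coord i)
  show ?case
    by (intro exI[of _ "\<lambda>p v. v $ i"]) (auto intro: elementary.const has_derivative_nth)
next
  case (add F G)
  then obtain F' G' where
    "\<forall>p\<in>U. (F has_derivative F' p) (at p)" "\<forall>i. elementary U (\<lambda>p. F' p (axis i 1))"
    "\<forall>p\<in>U. (G has_derivative G' p) (at p)" "\<forall>i. elementary U (\<lambda>p. G' p (axis i 1))"
    by blast
  then show ?case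
    by (intro exI[of _ "\<lambda>p v. F' p v + G' p v"])
       (auto intro!: elementary.add has_derivative_add)
next
  case (mult F G)
  then obtain F' G' where
    "\<forall>p\<in>U. (F has_derivative F' p) (at p)" "\<forall>i. elementary U (\<lambda>p. F' p (axis i 1))"
    "\<forall>p\<in>U. (G has_derivative G' p) (at p)" "\<forall>i. elementary U (\<lambda>p. G' p (axis i 1))"
    by blast
  with mult show ?case
    by (intro exI[of _ "\<lambda>p v. F p * G' p v + F' p v * G p"])
       (auto intro!: elementary.add elementary.mult has_derivative_mult)
next
  case (sin F)
  then obtain F' where F':
    "\<forall>p\<in>U. (F has_derivative F' p) (at p)" "\<forall>i. elementary U (\<lambda>p. F' p (axis i 1))"
    by blast
  have D: "((\<lambda>p. sin (F p)) has_derivative (\<lambda>v. F' p v * cos (F p))) (at p)" if "p \<in> U" for p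
    by (rule DERIV_compose_FDERIV[OF DERIV_sin F'(1)[rule_format, OF that]])
  have E: "elementary U (\<lambda>p. F' p (axis i 1) * cos (F p))" for i
    by (intro elementary.mult elementary.cos F'(2)[rule_format] sin.hyps)
  show ?case
    by (intro exI[of _ "\<lambda>p v. F' p v * cos (F p)"] conjI ballI allI D E)
next
  case (cos F)
  then obtain F' where F':
    "\<forall>p\<in>U. (F has_derivative F' p) (at p)" "\<forall>i. elementary U (\<lambda>p. F' p (axis i 1))"
    by blast
  have D: "((\<lambda>p. cos (F p)) has_derivative (\<lambda>v. F' p v * - sin (F p))) (at p)" if "p \<in> U" for p
    by (rule DERIV_compose_FDERIV[OF DERIV_cos F'(1)[rule_format, OF that]])
  have E: "elementary U (\<lambda>p. F' p (axis i 1) * - sin (F p))" for i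
    by (intro elementary.mult elementary_minus elementary.sin F'(2)[rule_format] cos.hyps)
  show ?case
    by (intro exI[of _ "\<lambda>p v. F' p v * - sin (F p)"] conjI ballI allI D E)
next
  case (inverse F)
  then obtain F' where F':
    "\<forall>p\<in>U. (F has_derivative F' p) (at p)" "\<forall>i. elementary U (\<lambda>p. F' p (axis i 1))"
    by blast
  have D: "((\<lambda>p. inverse (F p)) has_derivative (\<lambda>v. - (inverse (F p) * F' p v * inverse (F p)))) (at p)" if "p \<in> U" for p
    using that F'(1) inverse.hyps(2) by (intro Deriv.has_derivative_inverse) auto
  have E: "elementary U (\<lambda>p. - (inverse (F p) * F' p (axis i 1) * inverse (F p)))" for i
    by (intro elementary_minus elementary.mult elementary.inverse F'(2)[rule_format] inverse.hyps)
  show ?case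
    by (intro exI[of _ "\<lambda>p v. - (inverse (F p) * F' p v * inverse (F p))"] conjI ballI allI D E)
next
  case (sqrt F)
  then obtain F' where F':
    "\<forall>p\<in>U. (F has_derivative F' p) (at p)" "\<forall>i. elementary U (\<lambda>p. F' p (axis i 1))"
    by blast
  have D: "((\<lambda>p. sqrt (F p)) has_derivative (\<lambda>v. F' p v * (inverse (sqrt (F p)) / 2))) (at p)" if "p \<in> U" for p
    by (rule DERIV_compose_FDERIV[OF DERIV_real_sqrt[OF sqrt.hyps(2)[OF that]] F'(1)[rule_format, OF that]])
  have nz: "sqrt (F p) \<noteq> 0" if "p \<in> U" for p
    using sqrt.hyps(2)[OF that] by simp
  have E: "elementary U (\<lambda>p. F' p (axis i 1) * (inverse (sqrt (F p)) / 2))" for i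
    by (intro elementary.mult elementary_half elementary.inverse elementary.sqrt F'(2)[rule_format] sqrt.hyps nz)
  show ?case
    by (intro exI[of _ "\<lambda>p v. F' p v * (inverse (sqrt (F p)) / 2)"] conjI ballI allI D E)
next
  case (prim g i f)
  have "elementary U (\<lambda>p. g (p $ i) * axis j 1 $ i)" for j
    by (rule elementary.mult[OF prim(1) elementary.const])
  with prim(2) show ?case
    by (intro exI[of _ "\<lambda>p v. g (p $ i) * v $ i"]) (auto intro: has_derivative_comp_nth)
next
  case (cong F G)
  then obtain F' where F':
    "\<forall>p\<in>U. (F has_derivative F' p) (at p)" "\<forall>i. elementary U (\<lambda>p. F' p (axis i 1))"
    by blast
  moreover have "\<forall>p\<in>U. (G has_derivative F' p) (at p)"
    using has_derivative_cong_open[OF assms(2) _ cong(2)] F' by simp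
  ultimately show ?case
    by (intro exI[of _ F'] conjI)
qed

lemma elementary_pd:
  assumes "elementary U F" "open U"
  shows "elementary U (pd i F)" "p \<in> U \<Longrightarrow> F differentiable (at p)"
proof -
  obtain F' where F':
    "\<forall>p\<in>U. (F has_derivative F' p) (at p)" "\<forall>i. elementary U (\<lambda>p. F' p (axis i 1))"
    using elementary_has_derivative[OF assms] by blast
  then show "p \<in> U \<Longrightarrow> F differentiable (at p)"
    unfolding differentiable_def by blast
  show "elementary U (pd i F)"
    by (rule elementary.cong[OF F'(2)[rule_format, of i]]) (use F'(1) in \<open>simp add: pd_eqI\<close>)
qed

lemma elementary_smooth_on:
  assumes "elementary U F" "open U"
  shows "smooth_on U F"
proof (rule smooth_on_coinduct[of U "elementary U"])
  fix F assume F: "elementary U F"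
  have "\<exists>G. elementary U G \<and> (\<forall>p\<in>U. pd i F p = G p)" for i
    by (intro exI[of _ "pd i F"] conjI elementary_pd(1)[OF F assms(2)]) simp
  then show "(\<forall>p\<in>U. F differentiable (at p)) \<and>
      (\<forall>i. \<exists>G. elementary U G \<and> (\<forall>p\<in>U. pd i F p = G p))"
    using elementary_pd(2)[OF F assms(2)] by simp
qed (fact assms)+

text \<open>The invariant is componentwise. Differentiability of the vector-valued map comes first,
  since only then do components commute with \<open>pd\<close>.\<close>

lemma elementary_smooth_on_vec:
  fixes F :: "real^3 \<Rightarrow> real^'n"
  assumes "\<And>c. elementary U (\<lambda>p. F p $ c)" "open U"
  shows "smooth_on U F"
proof (rule smooth_on_coinduct[of U "\<lambda>F. \<forall>c. elementary U (\<lambda>p. F p $ c)"])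
  fix F :: "real^3 \<Rightarrow> real^'n"
  assume F: "\<forall>c. elementary U (\<lambda>p. F p $ c)"
  have diff: "F differentiable (at p)" if "p \<in> U" for p
  proof -
    have "\<forall>c. \<exists>D. ((\<lambda>p. F p $ c) has_derivative D) (at p)"
      using elementary_pd(2)[OF F[rule_format] assms(2) that] unfolding differentiable_def by blast
    then obtain D where "\<And>c. ((\<lambda>p. F p $ c) has_derivative D c) (at p)" by metis
    then have "(F has_derivative (\<lambda>v. \<chi> c. D c v)) (at p)"
      by (simp add: has_derivative_vec_componentwise)
    then show ?thesis by (rule differentiableI)
  qed
  have "elementary U (\<lambda>p. pd i F p $ c)" for i c
    by (rule elementary.cong[OF elementary_pd(1)[OF F[rule_format, of c] assms(2), of i]])
       (simp add: pd_nth diff)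
  then have "\<exists>G. (\<forall>c. elementary U (\<lambda>p. G p $ c)) \<and> (\<forall>p\<in>U. pd i F p = G p)" for i
    by (intro exI[of _ "pd i F"]) simp
  then show "(\<forall>p\<in>U. F differentiable (at p)) \<and>
      (\<forall>i. \<exists>G. (\<forall>c. elementary U (\<lambda>p. G p $ c)) \<and> (\<forall>p\<in>U. pd i F p = G p))"
    using diff by simp
qed (simp_all add: assms)

section \<open>Hypersurfaces with diagonal first and second fundamental forms\<close>

definition diag :: "(3 \<Rightarrow> real) \<Rightarrow> real^3^3" where
  "diag d = (\<chi> i j. if i = j then d i else 0)"

lemma diag_nth [simp]: "diag d $ i $ j = (if i = j then d i else 0)"
  by (simp add: diag_def)

lemma matrix_inv_eqI:
  fixes A B :: "real^'n^'n"
  assumes "A ** B = mat 1" "B ** A = mat 1"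
  shows "matrix_inv A = B"
proof -
  have "A ** matrix_inv A = mat 1 \<and> matrix_inv A ** A = mat 1"
    unfolding matrix_inv_def by (rule someI[of _ B]) (use assms in simp)
  then show ?thesis
    by (metis assms(2) matrix_mul_assoc matrix_mul_lid matrix_mul_rid)
qed

lemma diag_mult: "diag a ** diag b = diag (\<lambda>i. a i * b i)"
  by (simp add: vec_eq_iff matrix_matrix_mult_def if_distrib[of "\<lambda>x. x * _"] cong: if_cong)

lemma matrix_inv_diag:
  assumes "\<And>i. d i \<noteq> 0"
  shows "matrix_inv (diag d) = diag (\<lambda>i. 1 / d i)"
  by (rule matrix_inv_eqI) (simp_all add: diag_mult assms, simp_all add: vec_eq_iff mat_def)

text \<open>\<open>principal_curvatures\<close> is a choice, known only through the characteristic
  polynomial, so the trace has to be recovered by comparing coefficients.\<close>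

lemma a_coeff_1_diag: "a_coeff (diag d) 1 = - (d 1 + d 2 + d 3)"
proof -
  define \<kappa> where "\<kappa> = principal_curvatures (diag d)"
  have det: "det (mat z - (\<chi> i j. complex_of_real (diag d $ i $ j))) =
      (z - of_real (d 1)) * (z - of_real (d 2)) * (z - of_real (d 3))" for z
    by (simp add: det_3 mat_def)
  have "\<exists>\<kappa> :: complex^3. \<forall>z. det (mat z - (\<chi> i j. complex_of_real (diag d $ i $ j))) =
                 (z - \<kappa>$1) * (z - \<kappa>$2) * (z - \<kappa>$3)"
    by (rule exI[of _ "vector [of_real (d 1), of_real (d 2), of_real (d 3)]"]) (simp add: det del: diag_nth)
  from someI_ex[OF this, folded principal_curvatures_def, folded \<kappa>_def]
  have eq: "(z - of_real (d 1)) * (z - of_real (d 2)) * (z - of_real (d 3)) =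
      (z - \<kappa>$1) * (z - \<kappa>$2) * (z - \<kappa>$3)" for z
    by (simp add: det del: diag_nth)
  have "\<kappa>$1 + \<kappa>$2 + \<kappa>$3 = of_real (d 1 + d 2 + d 3)"
    \<comment> \<open>For a monic cubic p, the second difference p(1) - 2 p(0) + p(-1) is twice the
      coefficient of z^2, that is, minus twice the sum of the roots.\<close>
    using eq[of 0] eq[of 1] eq[of "-1"] by (simp add: algebra_simps) algebra
  then show ?thesis
    unfolding a_coeff_def Let_def \<kappa>_def[symmetric] by simp
qed

text \<open>The definite description needs uniqueness: pairing with the \<open>k\<close>-th
  coordinate vector isolates the entry in row \<open>k\<close>, multiplied by the nonzero number
  \<open>G k\<close>.\<close>

lemma shape_operator_diagI:
  assumes g: "induced_metric X p = diag G" "\<And>i. G i \<noteq> 0"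
    and N: "\<And>j. - pd j N p = d j *\<^sub>R pd j X p"
  shows "shape_operator X N p = diag d"
  unfolding shape_operator_def
proof (rule the_equality)
  show "\<forall>j. - pd j N p = (\<Sum>i\<in>UNIV. diag d $ i $ j *\<^sub>R pd i X p)"
    unfolding N by (simp add: if_distrib[of "\<lambda>x. x *\<^sub>R _"] cong: if_cong)
next
  fix S :: "real^3^3"
  assume S: "\<forall>j. - pd j N p = (\<Sum>i\<in>UNIV. S $ i $ j *\<^sub>R pd i X p)"
  have m: "mink (pd i X p) (pd k X p) = (if i = k then G i else 0)" for i k
    using g(1) by (simp add: induced_metric_def vec_eq_iff)
  have "S $ k $ j = diag d $ k $ j" for k j
  proof -
    have "mink (d j *\<^sub>R pd j X p) (pd k X p) =
        mink (\<Sum>i\<in>UNIV. S $ i $ j *\<^sub>R pd i X p) (pd k X p)"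
      using S N by simp
    moreover have "mink (\<Sum>i\<in>UNIV. S $ i $ j *\<^sub>R pd i X p) (pd k X p) =
        (\<Sum>i\<in>UNIV. S $ i $ j * mink (pd i X p) (pd k X p))"
      by (simp add: mink_def sum_3 algebra_simps)
    moreover have "mink (d j *\<^sub>R pd j X p) (pd k X p) = d j * mink (pd j X p) (pd k X p)"
      by (simp add: mink_def algebra_simps)
    ultimately show ?thesis
      using g(2)[of k] by (simp add: m if_distrib[of "\<lambda>x. _ * x"] cong: if_cong split: if_splits)
  qed
  then show "S = diag d" by (simp add: vec_eq_iff)
qed

text \<open>For a diagonal metric, the Christoffel symbol with upper index i and lower indices i, l
  is half the logarithmic derivative of \<open>G i\<close> along l. Diagonal entries suffice for a
  trace against a diagonal Newton transformation.\<close>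

lemma hessian_operator_diag:
  assumes U: "open U" "p \<in> U"
    and g: "\<And>q. q \<in> U \<Longrightarrow> induced_metric X q = diag (\<lambda>i. G i q)" "\<And>q i. q \<in> U \<Longrightarrow> G i q \<noteq> 0"
  shows "hessian_operator X \<phi> p $ i $ i = pd i (\<lambda>q. pd i \<phi> q / G i q) p +
    (\<Sum>l\<in>UNIV. pd l (G i) p / (2 * G i p) * (pd l \<phi> p / G l p))"
proof -
  have grad: "gradient X \<phi> q $ j = pd j \<phi> q / G j q" if "q \<in> U" for q j
    unfolding gradient_def using g that
    by (simp add: matrix_inv_diag matrix_vector_mult_def if_distrib[of "\<lambda>x. x * _"] cong: if_cong)
  have pdg: "pd l (\<lambda>q. induced_metric X q $ j $ k) p = (if j = k then pd l (G j) p else 0)" for l j k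
  proof -
    have "pd l (\<lambda>q. induced_metric X q $ j $ k) p = pd l (\<lambda>q. if j = k then G j q else 0) p"
      by (rule pd_cong_open[OF U]) (simp add: g)
    then show ?thesis
      by (simp add: pd_eqI[of "\<lambda>q. 0" "\<lambda>v. 0"])
  qed
  have chr: "christoffel X p i i l = pd l (G i) p / (2 * G i p)" for l
  proof -
    have "christoffel X p i i l = (\<Sum>m\<in>UNIV. (if i = m then
        1 / G i p * (pd i (\<lambda>q. induced_metric X q $ l $ m) p + pd l (\<lambda>q. induced_metric X q $ i $ m) p
         - pd m (\<lambda>q. induced_metric X q $ i $ l) p) else 0)) / 2"
      unfolding christoffel_def using U g
      by (intro arg_cong[of _ _ "\<lambda>x. x / 2"] sum.cong) (auto simp: matrix_inv_diag)
    then show ?thesis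
      by (auto simp: pdg)
  qed
  have "pd i (\<lambda>q. gradient X \<phi> q $ i) p = pd i (\<lambda>q. pd i \<phi> q / G i q) p"
    by (rule pd_cong_open[OF U grad])
  then show ?thesis
    unfolding hessian_operator_def by (simp add: chr grad U)
qed

text \<open>Here P_1 = a_1 I + S is diagonal; its entry at \<open>i\<close> is minus the sum of the
  other two principal curvatures.\<close>

lemma L_op_1_diag:
  assumes "shape_operator X N p = diag d"
  shows "L_op 1 X N \<phi> p =
    (\<Sum>i\<in>UNIV. (d i - (d 1 + d 2 + d 3)) * hessian_operator X \<phi> p $ i $ i)"
proof -
  have "newton_transformation (diag d) 1 = a_coeff (diag d) 1 *\<^sub>R mat 1 + diag d"
    by simp
  then have "newton_transformation (diag d) 1 = diag (\<lambda>i. d i - (d 1 + d 2 + d 3))"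
    unfolding a_coeff_1_diag by (simp add: vec_eq_iff mat_def)
  then show ?thesis
    unfolding L_op_def assms
    by (simp add: trace_def matrix_matrix_mult_def if_distrib[of "\<lambda>x. x * _"] cong: if_cong)
qed

section \<open>Rotational hypersurfaces about the timelike axis\<close>

text \<open>The metric coefficients and the components of the Gauss map are products of functions of
  one coordinate each, so this rule covers the differentiations below.\<close>

lemma pd_separated:
  fixes p :: "real^3"
  assumes "(a has_real_derivative a') (at (p $ 1))" "(b has_real_derivative b') (at (p $ 2))"
    "(c has_real_derivative c') (at (p $ 3))"
  shows "pd 1 (\<lambda>q. a (q $ 1) * b (q $ 2) * c (q $ 3)) p = a' * b (p $ 2) * c (p $ 3)"
    "pd 2 (\<lambda>q. a (q $ 1) * b (q $ 2) * c (q $ 3)) p = a (p $ 1) * b' * c (p $ 3)"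
    "pd 3 (\<lambda>q. a (q $ 1) * b (q $ 2) * c (q $ 3)) p = a (p $ 1) * b (p $ 2) * c'"
proof -
  have "((\<lambda>q. a (q $ 1) * b (q $ 2) * c (q $ 3)) has_derivative
     (\<lambda>v. a' * v $ 1 * b (p $ 2) * c (p $ 3) + a (p $ 1) * (b' * v $ 2) * c (p $ 3)
          + a (p $ 1) * b (p $ 2) * (c' * v $ 3))) (at p)"
    by (auto intro!: derivative_eq_intros has_derivative_comp_nth assms simp: algebra_simps)
  from pd_eqI[OF this] show
    "pd 1 (\<lambda>q. a (q $ 1) * b (q $ 2) * c (q $ 3)) p = a' * b (p $ 2) * c (p $ 3)"
    "pd 2 (\<lambda>q. a (q $ 1) * b (q $ 2) * c (q $ 3)) p = a (p $ 1) * b' * c (p $ 3)"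
    "pd 3 (\<lambda>q. a (q $ 1) * b (q $ 2) * c (q $ 3)) p = a (p $ 1) * b (p $ 2) * c'"
    by (simp_all add: axis_def)
qed

text \<open>The Gauss map is \<open>(n, h u)\<close> with \<open>u\<close> in the unit sphere; in terms of the profile curve,
  \<open>n = 1 / sqrt (f'\<^sup>2 - 1)\<close> and \<open>h = f' n\<close>.\<close>
locale rotation =
  fixes D :: "real set" and f n h h1 h2 :: "real \<Rightarrow> real"
  assumes open_D: "open D"
    and nonzero: "s \<in> D \<Longrightarrow> s \<noteq> 0"
    and deriv_f: "s \<in> D \<Longrightarrow> (f has_real_derivative h s / n s) (at s)"
    and n_pos: "s \<in> D \<Longrightarrow> 0 < n s"
    and n_squared: "s \<in> D \<Longrightarrow> (n s)\<^sup>2 = (h s)\<^sup>2 - 1"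
    and deriv_h: "s \<in> D \<Longrightarrow> (h has_real_derivative h1 s) (at s)"
    and deriv_h1: "s \<in> D \<Longrightarrow> (h1 has_real_derivative h2 s) (at s)"
begin

definition U :: "(real^3) set" where "U = {p. p $ 1 \<in> D \<and> cos (p $ 2) \<noteq> 0}"

abbreviation "X \<equiv> rot_hypersurface f"
abbreviation "N \<equiv> rot_gauss_map f"

lemma open_U: "open U"
proof -
  have "U = (\<lambda>p. p $ 1) -` D \<inter> {p. cos (p $ 2) \<noteq> 0}"
    by (auto simp: U_def)
  then show ?thesis
    by (auto intro!: open_Int open_vimage open_Collect_neq continuous_intros open_D)
qed

lemma deriv_n:
  assumes "s \<in> D"
  shows "(n has_real_derivative h s * h1 s / n s) (at s)"
proof -
  \<comment> \<open>Differentiability of \<open>n\<close> is obtained by identifying it on the open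
    set \<open>D\<close> with the positive root of h^2 - 1.\<close>
  have root: "sqrt ((h s)\<^sup>2 - 1) = n s" if "s \<in> D" for s
    unfolding n_squared[OF that, symmetric] using n_pos[OF that] by simp
  have pos: "(h s)\<^sup>2 - 1 > 0"
    unfolding n_squared[OF assms, symmetric] using n_pos[OF assms] by simp
  have "((\<lambda>s. (h s)\<^sup>2 - 1) has_real_derivative 2 * h s * h1 s) (at s)"
    by (rule derivative_eq_intros deriv_h assms refl)+ simp
  from DERIV_chain2[OF DERIV_real_sqrt[OF pos] this]
  have "((\<lambda>s. sqrt ((h s)\<^sup>2 - 1)) has_real_derivative h s * h1 s / n s) (at s)"
    unfolding root[OF assms] by (simp add: field_simps)
  then show ?thesis
    by (rule has_field_derivative_transform_within_open[OF _ open_D assms]) (rule root)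
qed

text \<open>Since f' = h / n, the identity n^2 = h^2 - 1 gives f'^2 - 1 = 1 / n^2, and
  \<open>n\<close> is its positive normalising factor.\<close>

lemma N_eq:
  assumes "p \<in> U"
  shows "N p = vector [n (p$1), - h (p$1) * cos (p$2) * sin (p$3), - h (p$1) * sin (p$2),
           h (p$1) * cos (p$2) * cos (p$3)]"
proof -
  have s: "p$1 \<in> D" using assms by (simp add: U_def)
  have d: "deriv f (p$1) = h (p$1) / n (p$1)"
    by (rule DERIV_imp_deriv[OF deriv_f[OF s]])
  have "(h (p$1) / n (p$1))\<^sup>2 - 1 = (1 / n (p$1))\<^sup>2"
    using n_pos[OF s] n_squared[OF s] by (simp add: field_simps)
  then have "sqrt ((h (p$1) / n (p$1))\<^sup>2 - 1) = 1 / n (p$1)"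
    using n_pos[OF s] by simp
  then show ?thesis
    using n_pos[OF s] unfolding rot_gauss_map_def Let_def d by (simp add: vec_eq_iff forall_4)
qed

lemma X_has_derivative:
  assumes "p \<in> U"
  shows "(X has_derivative (\<lambda>v. vector [h (p$1) / n (p$1) * v$1,
     - cos (p$2) * sin (p$3) * v$1 + p$1 * sin (p$2) * sin (p$3) * v$2 - p$1 * cos (p$2) * cos (p$3) * v$3,
     - sin (p$2) * v$1 - p$1 * cos (p$2) * v$2,
     cos (p$2) * cos (p$3) * v$1 - p$1 * sin (p$2) * cos (p$3) * v$2 - p$1 * cos (p$2) * sin (p$3) * v$3])) (at p)"
proof -
  have s: "p$1 \<in> D" using assms by (simp add: U_def)
  show ?thesis
    unfolding has_derivative_vec_componentwise rot_hypersurface_def Let_def forall_4 vector_4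
    by (intro conjI; (rule has_derivative_comp_nth[OF deriv_f[OF s]])?)
       (auto intro!: derivative_eq_intros has_derivative_nth simp: algebra_simps)
qed

lemma N_has_derivative:
  assumes "p \<in> U"
  shows "(N has_derivative (\<lambda>v. vector [h (p$1) * h1 (p$1) / n (p$1) * v$1,
     - h1 (p$1) * cos (p$2) * sin (p$3) * v$1 + h (p$1) * sin (p$2) * sin (p$3) * v$2 - h (p$1) * cos (p$2) * cos (p$3) * v$3,
     - h1 (p$1) * sin (p$2) * v$1 - h (p$1) * cos (p$2) * v$2,
     h1 (p$1) * cos (p$2) * cos (p$3) * v$1 - h (p$1) * sin (p$2) * cos (p$3) * v$2 - h (p$1) * cos (p$2) * sin (p$3) * v$3])) (at p)"
proof -
  have s: "p$1 \<in> D" using assms by (simp add: U_def)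
  note dh = has_derivative_comp_nth[OF deriv_h[OF s]]
  show ?thesis
    apply (subst has_derivative_cong_open[OF open_U assms N_eq], assumption)
    unfolding has_derivative_vec_componentwise forall_4 vector_4
    by (intro conjI; (rule has_derivative_comp_nth[OF deriv_n[OF s]])?)
       (auto intro!: derivative_eq_intros has_derivative_nth dh simp: algebra_simps)
qed

lemma pd_X:
  assumes "p \<in> U"
  shows "pd 1 X p = vector [h (p$1) / n (p$1), - cos (p$2) * sin (p$3), - sin (p$2), cos (p$2) * cos (p$3)]"
    "pd 2 X p = vector [0, p$1 * sin (p$2) * sin (p$3), - p$1 * cos (p$2), - p$1 * sin (p$2) * cos (p$3)]"
    "pd 3 X p = vector [0, - p$1 * cos (p$2) * cos (p$3), 0, - p$1 * cos (p$2) * sin (p$3)]"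
  unfolding pd_eqI[OF X_has_derivative[OF assms]] by (simp_all add: axis_def)

text \<open>The coordinate frame is principal: index 1 is the direction of the profile curve, the
  other two are tangent to the spheres of rotation and share one curvature.\<close>

definition shape :: "real \<Rightarrow> 3 \<Rightarrow> real" where
  "shape s i = (if i = 1 then - h1 s else - h s / s)"

lemma pd_N:
  assumes "p \<in> U"
  shows "- pd i N p = shape (p$1) i *\<^sub>R pd i X p"
proof -
  have s: "p$1 \<in> D" using assms by (simp add: U_def)
  have "\<forall>i. - pd i N p = shape (p$1) i *\<^sub>R pd i X p"
    using nonzero[OF s]
    unfolding forall_3 pd_X[OF assms] pd_eqI[OF N_has_derivative[OF assms]] shape_def
    by (simp add: axis_def vec_eq_iff forall_4)
  then show ?thesis by blast
qed

text \<open>The first coefficient is 1 - f'^2 = -1 / n^2, so the profile curve is timelike; the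
  other two form the metric of a sphere of radius |s| with latitude t.\<close>

definition G :: "3 \<Rightarrow> real^3 \<Rightarrow> real" where
  "G i q = (if i = 1 then - 1 / (n (q$1))\<^sup>2 else if i = 2 then (q$1)\<^sup>2 else (q$1)\<^sup>2 * (cos (q$2))\<^sup>2)"

lemma G_nonzero: "q \<in> U \<Longrightarrow> G i q \<noteq> 0"
  using n_pos[of "q$1"] nonzero[of "q$1"] by (auto simp: G_def U_def)

lemma metric:
  assumes "q \<in> U"
  shows "induced_metric X q = diag (\<lambda>i. G i q)"
proof -
  have s: "q$1 \<in> D" using assms by (simp add: U_def)
  note cs = sin_cos_squared_add[of "q$2"] sin_cos_squared_add[of "q$3"]
  have 1: "mink (pd 1 X q) (pd 1 X q) = - 1 / (n (q$1))\<^sup>2"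
  proof -
    have "mink (pd 1 X q) (pd 1 X q) = 1 - (h (q$1))\<^sup>2 / (n (q$1))\<^sup>2"
      unfolding pd_X[OF assms] mink_def vector_4 using cs
      by (simp add: power2_eq_square) algebra
    also have "\<dots> = ((n (q$1))\<^sup>2 - (h (q$1))\<^sup>2) / (n (q$1))\<^sup>2"
      using n_pos[OF s] by (simp add: diff_divide_distrib)
    also have "\<dots> = - 1 / (n (q$1))\<^sup>2"
      using n_squared[OF s] by simp
    finally show ?thesis .
  qed
  have 2: "mink (pd 2 X q) (pd 2 X q) = (q$1)\<^sup>2"
    unfolding pd_X[OF assms] mink_def vector_4 using cs by algebra
  have 3: "mink (pd 3 X q) (pd 3 X q) = (q$1)\<^sup>2 * (cos (q$2))\<^sup>2"
    unfolding pd_X[OF assms] mink_def vector_4 using cs by algebra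
  have 4: "mink (pd 1 X q) (pd 2 X q) = 0" "mink (pd 2 X q) (pd 1 X q) = 0"
    "mink (pd 1 X q) (pd 3 X q) = 0" "mink (pd 3 X q) (pd 1 X q) = 0"
    "mink (pd 2 X q) (pd 3 X q) = 0" "mink (pd 3 X q) (pd 2 X q) = 0"
    unfolding pd_X[OF assms] mink_def vector_4 using cs by algebra+
  show ?thesis
    by (simp add: induced_metric_def vec_eq_iff forall_3 1 2 3 4 G_def)
qed

lemma oriented_hypersurface_rotation:
  assumes "smooth_on U X" "smooth_on U N"
  shows "oriented_hypersurface U X N 1"
proof -
  have "det (induced_metric X p) \<noteq> 0 \<and> mink (N p) (N p) = 1 \<and> (\<forall>i. mink (N p) (pd i X p) = 0)"
    if p: "p \<in> U" for p
  proof (intro conjI)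
    have s: "p$1 \<in> D" using p by (simp add: U_def)
    note cs = sin_cos_squared_add[of "p$2"] sin_cos_squared_add[of "p$3"]
    show "det (induced_metric X p) \<noteq> 0"
      using G_nonzero[OF p] by (simp add: metric[OF p] det_3)
    show "mink (N p) (N p) = 1"
      unfolding N_eq[OF p] mink_def vector_4 using cs n_squared[OF s] by algebra
    have "mink (N p) (pd 1 X p) = 0"
    proof -
      \<comment> \<open>Naming the quotient leaves a polynomial identity, with n k = h as the only
        relation needed for the quotient.\<close>
      define k where "k = h (p$1) / n (p$1)"
      have k: "n (p$1) * k = h (p$1)" unfolding k_def using n_pos[OF s] by simp
      have "mink (N p) (pd 1 X p) = h (p$1) * ((sin (p$2))\<^sup>2 +
          (cos (p$2))\<^sup>2 * ((sin (p$3))\<^sup>2 + (cos (p$3))\<^sup>2)) - n (p$1) * k"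
        unfolding N_eq[OF p] pd_X[OF p] mink_def vector_4 k_def[symmetric]
        by algebra
      also have "\<dots> = 0"
        by (simp only: k cs mult_1_right)
      finally show ?thesis .
    qed
    moreover have "mink (N p) (pd 2 X p) = 0"
      unfolding N_eq[OF p] pd_X[OF p] mink_def vector_4 using cs by algebra
    moreover have "mink (N p) (pd 3 X p) = 0"
      unfolding N_eq[OF p] pd_X[OF p] mink_def vector_4 by simp
    ultimately show "\<forall>i. mink (N p) (pd i X p) = 0"
      by (simp add: forall_3)
  qed
  then show ?thesis
    unfolding oriented_hypersurface_def using open_U assms by simp
qed

lemma pd_G:
  assumes "p \<in> U"
  shows "pd 1 (G 1) p = 2 * h (p$1) * h1 (p$1) / (n (p$1))^4" "pd 2 (G 1) p = 0" "pd 3 (G 1) p = 0"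
    "pd 1 (G 2) p = 2 * p$1" "pd 2 (G 2) p = 0" "pd 3 (G 2) p = 0"
    "pd 1 (G 3) p = 2 * p$1 * (cos (p$2))\<^sup>2" "pd 2 (G 3) p = - 2 * (p$1)\<^sup>2 * cos (p$2) * sin (p$2)"
    "pd 3 (G 3) p = 0"
proof -
  have s: "p$1 \<in> D" using assms by (simp add: U_def)
  \<comment> \<open>Constant factors 1 put the metric coefficients into the product form of
    \<open>pd_separated\<close>.\<close>
  have one: "((\<lambda>_. 1) has_real_derivative 0) (at x)" for x by simp
  have n2: "((\<lambda>s. - 1 / (n s)\<^sup>2) has_real_derivative 2 * h (p$1) * h1 (p$1) / (n (p$1))^4) (at (p$1))"
    by (rule derivative_eq_intros deriv_n s refl)+
       (use n_pos[OF s] in \<open>auto simp: field_simps power2_eq_square power4_eq_xxxx\<close>)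
  have s2: "((\<lambda>s. s\<^sup>2) has_real_derivative 2 * p$1) (at (p$1))"
    by (auto intro!: derivative_eq_intros)
  have c2: "((\<lambda>s. (cos s)\<^sup>2) has_real_derivative - 2 * cos (p$2) * sin (p$2)) (at (p$2))"
    by (auto intro!: derivative_eq_intros)
  show "pd 1 (G 1) p = 2 * h (p$1) * h1 (p$1) / (n (p$1))^4" "pd 2 (G 1) p = 0" "pd 3 (G 1) p = 0"
    using pd_separated[OF n2 one one] by (simp_all add: G_def[abs_def])
  show "pd 1 (G 2) p = 2 * p$1" "pd 2 (G 2) p = 0" "pd 3 (G 2) p = 0"
    using pd_separated[OF s2 one one] by (simp_all add: G_def[abs_def])
  show "pd 1 (G 3) p = 2 * p$1 * (cos (p$2))\<^sup>2"
    "pd 2 (G 3) p = - 2 * (p$1)\<^sup>2 * cos (p$2) * sin (p$2)" "pd 3 (G 3) p = 0"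
    using pd_separated[OF s2 c2 one] by (simp_all add: G_def[abs_def])
qed

text \<open>The eigenvalues of P_1 are 2 h / s along the profile and h' + h / s on the spheres. The
  bracket divided by s^2 is the Laplacian of the unit sphere, applied to \<open>b\<close> times
  \<open>d\<close>; the remaining terms come from the radial derivatives.\<close>

lemma L_op_separated:
  fixes b b1 b2 d d1 d2 :: "real \<Rightarrow> real"
  assumes p: "p \<in> U"
    and r: "\<And>s. s \<in> D \<Longrightarrow> (r has_real_derivative r1 s) (at s)"
      "\<And>s. s \<in> D \<Longrightarrow> (r1 has_real_derivative r2 s) (at s)"
    and b: "\<And>t. (b has_real_derivative b1 t) (at t)" "\<And>t. (b1 has_real_derivative b2 t) (at t)"
    and d: "\<And>w. (d has_real_derivative d1 w) (at w)" "\<And>w. (d1 has_real_derivative d2 w) (at w)"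
    and \<phi>: "\<And>q. q \<in> U \<Longrightarrow> \<phi> q = r (q$1) * b (q$2) * d (q$3)"
    and stw: "s = p$1" "t = p$2" "w = p$3"
  shows "L_op 1 X N \<phi> p =
    - 2 * h s / s * ((n s)\<^sup>2 * r2 s + h s * h1 s * r1 s) * b t * d w
    + (h1 s + h s / s) * (- 2 * (n s)\<^sup>2 * r1 s * b t * d w / s
        + r s * (b2 t * d w - sin t / cos t * b1 t * d w + b t * d2 w / (cos t)\<^sup>2) / s\<^sup>2)"
proof -
  have s: "s \<in> D" and c: "cos t \<noteq> 0" using p stw by (simp_all add: U_def)
  note ns = n_pos[OF s] nonzero[OF s]
  have pd\<phi>: "pd 1 \<phi> q = r1 (q$1) * b (q$2) * d (q$3)" "pd 2 \<phi> q = r (q$1) * b1 (q$2) * d (q$3)"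
    "pd 3 \<phi> q = r (q$1) * b (q$2) * d1 (q$3)" if q: "q \<in> U" for q
  proof -
    have "q$1 \<in> D" using q by (simp add: U_def)
    note * = pd_separated[OF r(1)[OF this] b(1) d(1)]
    show "pd 1 \<phi> q = r1 (q$1) * b (q$2) * d (q$3)" "pd 2 \<phi> q = r (q$1) * b1 (q$2) * d (q$3)"
      "pd 3 \<phi> q = r (q$1) * b (q$2) * d1 (q$3)"
      by (simp_all only: pd_cong_open[OF open_U q \<phi>] *)
  qed
  have 1: "pd 1 (\<lambda>q. pd 1 \<phi> q / G 1 q) p = - (2 * h s * h1 s * r1 s + (n s)\<^sup>2 * r2 s) * b t * d w"
  proof -
    have "pd 1 (\<lambda>q. pd 1 \<phi> q / G 1 q) p =
        pd 1 (\<lambda>q. - (n (q$1))\<^sup>2 * r1 (q$1) * b (q$2) * d (q$3)) p"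
      by (rule pd_cong_open[OF open_U p]) (simp add: pd\<phi> G_def)
    moreover have "((\<lambda>s. - (n s)\<^sup>2 * r1 s) has_real_derivative
        - (2 * h s * h1 s * r1 s + (n s)\<^sup>2 * r2 s)) (at (p$1))"
      unfolding stw(1)[symmetric]
      by (rule derivative_eq_intros deriv_n r(2) s refl)+
         (use ns in \<open>auto simp: field_simps power2_eq_square\<close>)
    from pd_separated(1)[OF this b(1) d(1)]
    have "pd 1 (\<lambda>q. - (n (q$1))\<^sup>2 * r1 (q$1) * b (q$2) * d (q$3)) p =
        - (2 * h s * h1 s * r1 s + (n s)\<^sup>2 * r2 s) * b t * d w"
      by (simp add: stw)
    ultimately show ?thesis by simp
  qed
  have 2: "pd 2 (\<lambda>q. pd 2 \<phi> q / G 2 q) p = r s * b2 t * d w / s\<^sup>2"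
  proof -
    have "pd 2 (\<lambda>q. pd 2 \<phi> q / G 2 q) p =
        pd 2 (\<lambda>q. r (q$1) / (q$1)\<^sup>2 * b1 (q$2) * d (q$3)) p"
      by (rule pd_cong_open[OF open_U p]) (simp add: pd\<phi> G_def)
    moreover have "((\<lambda>s. r s / s\<^sup>2) has_real_derivative
        (r1 s * s\<^sup>2 - r s * (2 * s)) / (s\<^sup>2 * s\<^sup>2)) (at (p$1))"
      unfolding stw(1)[symmetric]
      by (rule derivative_eq_intros r(1) s refl)+ (use ns in auto)
    from pd_separated(2)[OF this b(2) d(1)]
    have "pd 2 (\<lambda>q. r (q$1) / (q$1)\<^sup>2 * b1 (q$2) * d (q$3)) p = r s * b2 t * d w / s\<^sup>2"
      by (simp add: stw)
    ultimately show ?thesis by simp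
  qed
  have 3: "pd 3 (\<lambda>q. pd 3 \<phi> q / G 3 q) p = r s * b t * d2 w / (s\<^sup>2 * (cos t)\<^sup>2)"
  proof -
    have "pd 3 (\<lambda>q. pd 3 \<phi> q / G 3 q) p =
        pd 3 (\<lambda>q. r (q$1) / (q$1)\<^sup>2 * (b (q$2) / (cos (q$2))\<^sup>2) * d1 (q$3)) p"
      by (rule pd_cong_open[OF open_U p]) (simp add: pd\<phi> G_def)
    moreover have r': "((\<lambda>s. r s / s\<^sup>2) has_real_derivative
        (r1 s * s\<^sup>2 - r s * (2 * s)) / (s\<^sup>2 * s\<^sup>2)) (at (p$1))"
      unfolding stw(1)[symmetric]
      by (rule derivative_eq_intros r(1) s refl)+ (use ns in auto)
    have b': "((\<lambda>t. b t / (cos t)\<^sup>2) has_real_derivative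
        (b1 t * (cos t)\<^sup>2 - b t * (2 * cos t * - sin t)) / ((cos t)\<^sup>2 * (cos t)\<^sup>2)) (at (p$2))"
      unfolding stw(2)[symmetric]
      by (rule derivative_eq_intros b(1) refl)+ (use c in auto)
    from pd_separated(3)[OF r' b' d(2)]
    have "pd 3 (\<lambda>q. r (q$1) / (q$1)\<^sup>2 * (b (q$2) / (cos (q$2))\<^sup>2) * d1 (q$3)) p =
        r s * b t * d2 w / (s\<^sup>2 * (cos t)\<^sup>2)"
      by (simp add: stw)
    ultimately show ?thesis by simp
  qed
  have H: "hessian_operator X \<phi> p $ i $ i = pd i (\<lambda>q. pd i \<phi> q / G i q) p +
      (\<Sum>l\<in>UNIV. pd l (G i) p / (2 * G i p) * (pd l \<phi> p / G l p))" for i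
    by (rule hessian_operator_diag[OF open_U p metric G_nonzero])
  \<comment> \<open>The Christoffel term cancels half of the term 2 h h' r' produced by
    differentiating n^2 r'.\<close>
  have h11: "hessian_operator X \<phi> p $ 1 $ 1 = - ((n s)\<^sup>2 * r2 s + h s * h1 s * r1 s) * b t * d w"
    unfolding H 1 unfolding sum_3 pd_G[OF p] pd\<phi>[OF p] G_def stw[symmetric]
    using ns by (simp add: field_simps power2_eq_square power4_eq_xxxx)
  have h22: "hessian_operator X \<phi> p $ 2 $ 2 =
      r s * b2 t * d w / s\<^sup>2 - (n s)\<^sup>2 * r1 s * b t * d w / s"
    unfolding H 2 unfolding sum_3 pd_G[OF p] pd\<phi>[OF p] G_def stw[symmetric]
    using ns by (simp add: field_simps power2_eq_square)
  have h33: "hessian_operator X \<phi> p $ 3 $ 3 =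
      r s * b t * d2 w / (s\<^sup>2 * (cos t)\<^sup>2) - (n s)\<^sup>2 * r1 s * b t * d w / s
      - sin t / cos t * r s * b1 t * d w / s\<^sup>2"
    unfolding H 3 unfolding sum_3 pd_G[OF p] pd\<phi>[OF p] G_def stw[symmetric]
    using ns c by (simp add: field_simps power2_eq_square)
  show ?thesis
    unfolding L_op_1_diag[OF shape_operator_diagI[OF metric[OF p] G_nonzero[OF p] pd_N[OF p]]]
      sum_3 h11 h22 h33 shape_def stw[symmetric]
    by (simp add: algebra_simps add_divide_distrib diff_divide_distrib)
qed

text \<open>The hypothesis says that \<open>a\<^sub>2 = (s h\<^sup>2)' / s\<^sup>2\<close> is constant, so that the tangential part of
  \<open>L\<^sub>1 N\<close> vanishes.\<close>
lemma L_vec_N: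
  assumes p: "p \<in> U" and s: "s = p$1"
    and ode: "h s * h2 s = (h s)\<^sup>2 / s\<^sup>2 - (h1 s)\<^sup>2"
  shows "L_vec 1 X N N p = (- 2 * h s / s * ((h s)\<^sup>2 / s\<^sup>2 + (h1 s)\<^sup>2 + h s * h1 s / s)) *\<^sub>R N p"
    (is "_ = ?m *\<^sub>R _")
proof -
  have sD: "s \<in> D" and c: "cos (p$2) \<noteq> 0" using p s by (simp_all add: U_def)
  note ns = n_pos[OF sD] nonzero[OF sD]
  have const: "((\<lambda>_. k) has_real_derivative 0) (at x)" for k x by simp
  have n1: "((\<lambda>s. h s * h1 s / n s) has_real_derivative
      ((h1 s * h1 s + h s * h2 s) * n s - h s * h1 s * (h s * h1 s / n s)) / (n s * n s)) (at s)"
    if "s \<in> D" for s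
    by (rule derivative_eq_intros deriv_h deriv_h1 deriv_n that refl)+
       (use n_pos[OF that] in \<open>auto simp: algebra_simps\<close>)
  have dsin: "(sin has_real_derivative cos x) (at x)"
    and dcos: "(cos has_real_derivative - sin x) (at x)"
    and dmsin: "((\<lambda>x. - sin x) has_real_derivative - cos x) (at x)"
    and dmcos: "((\<lambda>x. - cos x) has_real_derivative sin x) (at x)" for x :: real
    by (auto intro!: derivative_eq_intros)
  \<comment> \<open>Up to sign, \<open>a\<close> is the double principal curvature. Substituting h =
    a s clears the divisions by \<open>s\<close>, so that polynomial reasoning applies.\<close>
  define a where "a = h s / s"
  have hs: "h s = a * s" using ns by (simp add: a_def)
  have ode': "a * s * h2 s = a\<^sup>2 - (h1 s)\<^sup>2"
    using ode ns unfolding hs by (simp add: power_mult_distrib)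
  have nn: "(n s)\<^sup>2 = a\<^sup>2 * s\<^sup>2 - 1"
    using n_squared[OF sD] hs by (simp add: power_mult_distrib)
  have m: "?m = - 2 * a * (a\<^sup>2 + (h1 s)\<^sup>2 + a * h1 s)"
    using ns by (simp add: hs power_mult_distrib)
  \<comment> \<open>The time component is \<open>n\<close>, a function of \<open>s\<close> alone;
    its angular factors are the constant 1.\<close>
  have time: "L_op 1 X N (\<lambda>q. N q $ 1) p = ?m * N p $ 1"
  proof -
    have "L_op 1 X N (\<lambda>q. N q $ 1) p =
      - 2 * h s / s * ((n s)\<^sup>2 * (((h1 s * h1 s + h s * h2 s) * n s - h s * h1 s * (h s * h1 s / n s)) / (n s * n s))
           + h s * h1 s * (h s * h1 s / n s))
      + (h1 s + h s / s) * (- 2 * (n s)\<^sup>2 * (h s * h1 s / n s) / s)"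
      by (subst L_op_separated[OF p deriv_n n1 const[of 1] const const[of 1] const _ s refl refl])
         (simp_all add: N_eq)
    also have "\<dots> = - 2 * h s / s * (n s * (h1 s * h1 s + h s * h2 s))
        + (h1 s + h s / s) * (- 2 * n s * (h s * h1 s) / s)"
      using ns by (simp add: field_simps power2_eq_square)
    also have "\<dots> = - 2 * a * (n s * (h1 s * h1 s + a * s * h2 s)) + (h1 s + a) * (- 2 * n s * (a * h1 s))"
      using ns by (simp add: hs)
    also have "\<dots> = ?m * n s"
      unfolding m using ode' by algebra
    finally show ?thesis by (simp add: N_eq[OF p] s)
  qed
  \<comment> \<open>This is the radial coefficient of L_1 applied to \<open>h\<close> times a
    spherical function of Laplace eigenvalue -2.\<close>
  define K where "K = - 2 * a * ((n s)\<^sup>2 * h2 s + h s * h1 s * h1 s)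
      + (h1 s + a) * (- 2 * (n s)\<^sup>2 * h1 s / s - 2 * h s / s\<^sup>2)"
  have K: "K = ?m * h s"
  proof -
    have "s * K = - 2 * a * ((n s)\<^sup>2 * (s * h2 s) + s * a * s * h1 s * h1 s)
      + (h1 s + a) * (- 2 * (n s)\<^sup>2 * h1 s - 2 * a)"
      using ns unfolding K_def hs by (simp add: field_simps power2_eq_square)
    also have "\<dots> = s * (?m * h s)"
      unfolding m unfolding hs nn using ode' by algebra
    finally show ?thesis using ns(2) by (simp only: mult_cancel_left) simp
  qed
  have cs: "sin (p$2) * sin (p$2) = 1 - cos (p$2) * cos (p$2)"
    using sin_cos_squared_add[of "p$2"] by (simp add: power2_eq_square)
  \<comment> \<open>The premise is the eigenvalue equation for -2 on the unit sphere. The coordinate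
    functions of the sphere, which form the spatial part of the Gauss map, satisfy it.\<close>
  have sphere: "b2 t * d w - sin t / cos t * b1 t * d w + b t * d2 w / (cos t)\<^sup>2 = - 2 * (b t * d w) \<Longrightarrow>
      - 2 * h s / s * ((n s)\<^sup>2 * h2 s + h s * h1 s * h1 s) * b t * d w
    + (h1 s + h s / s) * (- 2 * (n s)\<^sup>2 * h1 s * b t * d w / s
        + h s * (b2 t * d w - sin t / cos t * b1 t * d w + b t * d2 w / (cos t)\<^sup>2) / s\<^sup>2)
      = ?m * (h s * (b t * d w))" for b b1 b2 d d2 :: "real \<Rightarrow> real" and t w
  proof -
    assume *: "b2 t * d w - sin t / cos t * b1 t * d w + b t * d2 w / (cos t)\<^sup>2 = - 2 * (b t * d w)"
    have "?m * (h s * (b t * d w)) = K * (b t * d w)" unfolding K by simp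
    then show ?thesis
      unfolding * K_def a_def by (simp add: algebra_simps)
  qed
  \<comment> \<open>In components 2 and 3 the minus sign is put into the latitude factor, so that
    the radial factor is always \<open>h\<close>.\<close>
  have 2: "L_op 1 X N (\<lambda>q. N q $ 2) p = ?m * N p $ 2"
    by (subst L_op_separated[OF p deriv_h deriv_h1 dmcos dsin dsin dcos _ s refl refl], assumption+,
        simp add: N_eq, subst sphere)
       (use c in \<open>simp_all add: N_eq[OF p] s, simp add: field_simps cs power2_eq_square\<close>)
  have 3: "L_op 1 X N (\<lambda>q. N q $ 3) p = ?m * N p $ 3"
    by (subst L_op_separated[OF p deriv_h deriv_h1 dmsin dmcos const[of 1] const _ s refl refl], assumption+,
        simp add: N_eq, subst sphere)
       (use c in \<open>simp_all add: N_eq[OF p] s\<close>)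
  have 4: "L_op 1 X N (\<lambda>q. N q $ 4) p = ?m * N p $ 4"
    by (subst L_op_separated[OF p deriv_h deriv_h1 dcos dmsin dcos dmsin _ s refl refl], assumption+,
        simp add: N_eq, subst sphere)
       (use c in \<open>simp_all add: N_eq[OF p] s, simp add: field_simps cs power2_eq_square\<close>)
  show ?thesis
    \<comment> \<open>The index 1 must not be rewritten to \<open>Suc 0\<close>, or the four
      component equations would no longer match.\<close>
    unfolding L_vec_def vec_eq_iff forall_4 by (simp del: One_nat_def add: time 2 3 4)
qed

end

section \<open>The profile curve\<close>

text \<open>\<open>c\<close>, \<open>d\<close>, \<open>e\<close> stand for the constants c10, c11,
  c12.\<close>

locale profile_with_constant_a2 =
  fixes \<sigma> c d e :: real
  assumes sign: "\<sigma> = 1 \<or> \<sigma> = -1"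
begin

abbreviation "D \<equiv> profile_domain c d"

definition P :: "real \<Rightarrow> real" where "P x = 2 * (6 * c * d * x^3 + c)"
definition Q :: "real \<Rightarrow> real" where "Q x = 12 * c * d * x^3 + 3 * x + 2 * c"
text \<open>For s < 0 the divisor -3 s is positive. From Q = P + 3 s follows h^2 - n^2 = 1, and h /
  n is the signed integrand. The sign goes into \<open>h\<close>, because \<open>n\<close> has to be
  positive.\<close>

definition n :: "real \<Rightarrow> real" where "n s = sqrt (Q s / (- 3 * s))"
definition h :: "real \<Rightarrow> real" where "h s = \<sigma> * sqrt (P s / (- 3 * s))"
text \<open>The numerator is the derivative of h^2 = -4 c d s^2 - 2 c / (3 s), so this is h' read
  off from (h^2)' = 2 h h'.\<close>

definition h1 :: "real \<Rightarrow> real" where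
  "h1 s = (- 8 * c * d * s + 2 * c / (3 * s\<^sup>2)) / (2 * h s)"
text \<open>For this profile \<open>(h\<^sup>2)'' = 2 h\<^sup>2 / s\<^sup>2\<close>, which is solved here for \<open>h''\<close>.\<close>
definition h2 :: "real \<Rightarrow> real" where
  "h2 s = ((h s)\<^sup>2 / s\<^sup>2 - (h1 s)\<^sup>2) / h s"

lemma Q_eq: "Q x = P x + 3 * x"
  by (simp add: P_def Q_def)

lemma in_D_iff: "s \<in> D \<longleftrightarrow> s < 0 \<and> (\<forall>x\<in>{s..1}. 0 \<le> P x \<and> 0 < Q x)"
  by (simp add: profile_domain_def P_def Q_def)

text \<open>Strict positivity of \<open>P s\<close> comes from P = Q - 3 s with Q > 0 and s < 0; it
  keeps \<open>h\<close> away from zero.\<close>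

lemma D_facts:
  assumes "s \<in> D"
  shows "s < 0" "0 < P s" "0 < Q s"
  using assms Q_eq[of s] by (auto simp: in_D_iff dest!: bspec[of _ _ s])

text \<open>Moving the left end of the interval from \<open>s\<close> to a nearby \<open>y\<close>
  adds only points close to \<open>s\<close>. There Q > 0 and x < 0 persist by continuity, and P = Q
  - 3 x is then positive as well.\<close>

lemma open_D: "open D"
  unfolding open_dist
proof
  fix s assume s: "s \<in> D"
  have "open ({x. 0 < Q x} \<inter> {..<0})"
    unfolding Q_def by (intro open_Int open_Collect_less continuous_intros open_lessThan)
  then obtain r where r: "r > 0" "ball s r \<subseteq> {x. 0 < Q x} \<inter> {..<0}"
    using D_facts[OF s] open_contains_ball by blast
  have "y \<in> D" if y: "dist y s < r" for y
  proof -
    have near: "0 < Q x" "x < 0" if "\<bar>x - s\<bar> < r" for x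
      using r(2) that by (auto simp: dist_real_def abs_minus_commute)
    have "0 \<le> P x \<and> 0 < Q x" if x: "x \<in> {y..1}" for x
    proof (cases "s \<le> x")
      case True
      then show ?thesis using s x by (auto simp: in_D_iff)
    next
      case False
      then have "\<bar>x - s\<bar> < r" using x y by (auto simp: dist_real_def)
      from near[OF this] show ?thesis using Q_eq[of x] by auto
    qed
    then show ?thesis
      using near[of y] y by (auto simp: in_D_iff dist_real_def)
  qed
  then show "\<exists>r>0. \<forall>y. dist y s < r \<longrightarrow> y \<in> D" using r(1) by blast
qed

lemma h_squared: "s \<in> D \<Longrightarrow> (h s)\<^sup>2 = P s / (- 3 * s)"
  using D_facts[of s] sign by (auto simp: h_def power_mult_distrib divide_nonneg_neg)

lemma h_nonzero: "s \<in> D \<Longrightarrow> h s \<noteq> 0"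
  using h_squared[of s] D_facts[of s] by auto

lemma n_pos: "s \<in> D \<Longrightarrow> 0 < n s"
  using D_facts[of s] by (simp add: n_def divide_pos_neg)

lemma n_squared:
  assumes "s \<in> D"
  shows "(n s)\<^sup>2 = (h s)\<^sup>2 - 1"
proof -
  have "(n s)\<^sup>2 = Q s / (- 3 * s)"
    using D_facts[OF assms] by (simp add: n_def divide_nonneg_neg)
  also have "\<dots> = (h s)\<^sup>2 - 1"
    using D_facts[OF assms] unfolding h_squared[OF assms] Q_eq by (simp add: field_simps)
  finally show ?thesis .
qed

lemma h_div_n:
  assumes "s \<in> D"
  shows "h s / n s = \<sigma> * (sqrt (P s) / sqrt (Q s))"
proof -
  have "P s / (- 3 * s) / (Q s / (- 3 * s)) = P s / Q s"
    using D_facts[OF assms] by simp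
  then show ?thesis
    unfolding h_def n_def by (metis real_sqrt_divide times_divide_eq_right)
qed

lemma deriv_profile:
  assumes s: "s \<in> D"
  shows "(profile \<sigma> c d e has_real_derivative h s / n s) (at s)"
proof -
  obtain r where r: "r > 0" "ball s r \<subseteq> D"
    using open_D s open_contains_ball by blast
  \<comment> \<open>A point of \<open>D\<close> to the left of \<open>s\<close>: the integrand is
    continuous on \<open>{a..1}\<close> and \<open>s\<close> is interior, so the one-interval
    derivative is a full derivative.\<close>
  define a where "a = s - r / 2"
  have a: "a \<in> D" "a < s" using r by (auto simp: a_def dist_real_def)
  have s0: "s < 0" using D_facts[OF s] by simp
  have "continuous_on {a..1} (\<lambda>x. sqrt (P x) / sqrt (Q x))"
  proof (intro continuous_intros ballI)
    show "continuous_on {a..1} P" "continuous_on {a..1} Q"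
      unfolding P_def[abs_def] Q_def[abs_def] by (intro continuous_intros)+
    show "sqrt (Q x) \<noteq> 0" if "x \<in> {a..1}" for x
      using a(1) that by (auto simp: in_D_iff dest!: bspec[of _ _ x])
  qed
  then have "((\<lambda>u. LBINT x=ereal 1..ereal u. sqrt (P x) / sqrt (Q x)) has_vector_derivative
      sqrt (P s) / sqrt (Q s)) (at s within {a..1})"
    using a s0 by (intro interval_integral_FTC2[of a 1 1]) auto
  moreover have "at s within {a..1} = at s"
    using a(2) s0 by (intro at_within_interior) auto
  ultimately have "((\<lambda>u. LBINT x=ereal 1..ereal u. sqrt (P x) / sqrt (Q x)) has_real_derivative
      sqrt (P s) / sqrt (Q s)) (at s)"
    by (simp add: has_real_derivative_iff_has_vector_derivative)
  from DERIV_add[OF DERIV_cmult[OF this, of \<sigma>] DERIV_const[of e]]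
  show ?thesis
    unfolding h_div_n[OF s] profile_def[abs_def] P_def Q_def by simp
qed

lemma deriv_h:
  assumes s: "s \<in> D"
  shows "(h has_real_derivative h1 s) (at s)"
proof -
  note s0 = D_facts[OF s]
  have pos: "P s / (- 3 * s) > 0" using s0 by (simp add: divide_pos_neg)
  have P': "(P has_real_derivative 36 * c * d * s\<^sup>2) (at s)"
    unfolding P_def[abs_def] by (rule derivative_eq_intros refl)+ simp
  have "((\<lambda>s. - 3 * s) has_real_derivative - 3) (at s)"
    by (rule derivative_eq_intros refl)+ simp
  from DERIV_divide[OF P' this] s0
  have "((\<lambda>s. P s / (- 3 * s)) has_real_derivative
      (36 * c * d * s\<^sup>2 * (- 3 * s) - P s * - 3) / (- 3 * s * (- 3 * s))) (at s)"
    by simp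
  moreover have "(36 * c * d * s\<^sup>2 * (- 3 * s) - P s * - 3) / (- 3 * s * (- 3 * s)) =
      - 8 * c * d * s + 2 * c / (3 * s\<^sup>2)"
    unfolding P_def using s0 by (simp add: field_simps power2_eq_square power3_eq_cube)
  ultimately have "((\<lambda>s. P s / (- 3 * s)) has_real_derivative
      - 8 * c * d * s + 2 * c / (3 * s\<^sup>2)) (at s)"
    by simp
  from DERIV_cmult[OF DERIV_chain2[OF DERIV_real_sqrt[OF pos] this], of \<sigma>]
  have deriv: "(h has_real_derivative \<sigma> * (inverse (sqrt (P s / (- 3 * s))) / 2 *
      (- 8 * c * d * s + 2 * c / (3 * s\<^sup>2)))) (at s)"
    unfolding h_def[abs_def] .
  \<comment> \<open>The sign is its own inverse and may therefore move into the denominator.\<close>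
  have "\<sigma> * (inverse x / 2 * y) = y / (2 * (\<sigma> * x))" for x y
    using sign by (elim disjE; simp; simp add: field_simps)
  from deriv[unfolded this] show ?thesis
    unfolding h1_def h_def[of s] .
qed

text \<open>h^2 is a combination of s^2 and 1 / s, both solutions of y'' = 2 y / s^2. The quotient
  rule for (h^2)' / (2 h) then yields \<open>h2\<close>.\<close>

lemma deriv_h1:
  assumes s: "s \<in> D"
  shows "(h1 has_real_derivative h2 s) (at s)"
proof -
  note s0 = D_facts[OF s] and hn = h_nonzero[OF s]
  define R1 where "R1 = - 8 * c * d * s + 2 * c / (3 * s\<^sup>2)"
  have R1: "R1 = 2 * h s * h1 s" using hn by (simp add: h1_def R1_def)
  have R2: "- 8 * c * d - 4 * c / (3 * s^3) = 2 * (h s)\<^sup>2 / s\<^sup>2"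
    unfolding h_squared[OF s] P_def using s0
    by (simp add: field_simps power2_eq_square power3_eq_cube)
  have "((\<lambda>s. 3 * s\<^sup>2) has_real_derivative 6 * s) (at s)"
    by (rule derivative_eq_intros refl)+ simp
  from DERIV_add[OF DERIV_cmult_Id[of "- 8 * c * d"] DERIV_divide[OF DERIV_const[of "2 * c"] this]] s0
  have "((\<lambda>s. - 8 * c * d * s + 2 * c / (3 * s\<^sup>2)) has_real_derivative
      - 8 * c * d + (0 * (3 * s\<^sup>2) - 2 * c * (6 * s)) / (3 * s\<^sup>2 * (3 * s\<^sup>2))) (at s)"
    by simp
  moreover have "(0 * (3 * s\<^sup>2) - 2 * c * (6 * s)) / (3 * s\<^sup>2 * (3 * s\<^sup>2)) = - 4 * c / (3 * s^3)"
    using s0 by (simp add: field_simps power2_eq_square power3_eq_cube)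
  ultimately have "((\<lambda>s. - 8 * c * d * s + 2 * c / (3 * s\<^sup>2)) has_real_derivative
      (- 8 * c * d - 4 * c / (3 * s^3))) (at s)"
    by simp
  from DERIV_divide[OF this DERIV_cmult[OF deriv_h[OF s], of 2]] hn
  have "(h1 has_real_derivative
      ((2 * (h s)\<^sup>2 / s\<^sup>2) * (2 * h s) - R1 * (2 * h1 s)) / (2 * h s * (2 * h s))) (at s)"
    unfolding R2 R1_def h1_def[abs_def] by simp
  moreover have "((2 * (h s)\<^sup>2 / s\<^sup>2) * (2 * h s) - R1 * (2 * h1 s)) / (2 * h s * (2 * h s)) = h2 s"
    unfolding R1 h2_def using hn s0 by (simp add: field_simps power2_eq_square)
  ultimately show ?thesis by simp
qed

sublocale rotation "profile_domain c d" "profile \<sigma> c d e" n h h1 h2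
  by unfold_locales
     (use open_D D_facts deriv_profile n_pos n_squared deriv_h deriv_h1 in \<open>auto\<close>)

lemma U_eq: "U = param_domain c d"
  by (simp add: U_def param_domain_def)

section \<open>The proportionality factor of L_1 N and N\<close>

definition factor :: "real \<Rightarrow> real" where
  "factor s = - 2 * c\<^sup>2 * (1 + 12 * d * s^3 * (1 + 12 * d * s^3)) / (3 * s^5 * h s)"

text \<open>After multiplication by \<open>h\<close>, only h^2 and h h' occur, which are rational in
  \<open>s\<close>. With q = 12 d s^3 the numerators reduce to (q+2)^2 + (q-1)^2 + (q+2)(q-1) = 3 (1
  + q + q^2).\<close>

lemma factor_eq:
  assumes s: "s \<in> D"
  shows "- 2 * h s / s * ((h s)\<^sup>2 / s\<^sup>2 + (h1 s)\<^sup>2 + h s * h1 s / s) = factor s"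
proof -
  note s0 = D_facts[OF s] and hn = h_nonzero[OF s]
  define q where "q = 12 * d * s^3"
  have a: "(h s)\<^sup>2 = - c * (q + 2) / (3 * s)"
    unfolding h_squared[OF s] P_def q_def using s0 by (simp add: field_simps)
  have b: "h s * h1 s = - c * (q - 1) / (3 * s\<^sup>2)"
    unfolding h1_def q_def using s0 hn
    by (simp add: field_simps power2_eq_square power3_eq_cube)
  have "h s * (- 2 * h s / s * ((h s)\<^sup>2 / s\<^sup>2 + (h1 s)\<^sup>2 + h s * h1 s / s)) =
      - 2 / s * (((h s)\<^sup>2)\<^sup>2 / s\<^sup>2 + (h s * h1 s)\<^sup>2 + (h s)\<^sup>2 * (h s * h1 s) / s)"
    by (simp add: field_simps power2_eq_square)
  also have "\<dots> = - 2 * c\<^sup>2 * (1 + q * (1 + q)) / (3 * s^5)"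
    unfolding a b using s0 by (simp add: field_simps power_def numeral_eq_Suc)
  also have "\<dots> = h s * factor s"
    using hn by (simp add: factor_def q_def)
  finally show ?thesis using hn by (simp only: mult_cancel_left) simp
qed

lemma L_vec_eq:
  assumes "p \<in> U"
  shows "L_vec 1 X N N p = factor (p$1) *\<^sub>R N p"
proof -
  have s: "p$1 \<in> D" using assms by (simp add: U_def)
  \<comment> \<open>This holds by the definition of \<open>h2\<close>; that \<open>h2\<close> really
    is h'' was the content of \<open>deriv_h1\<close>.\<close>
  have "h (p$1) * h2 (p$1) = (h (p$1))\<^sup>2 / (p$1)\<^sup>2 - (h1 (p$1))\<^sup>2"
    using h_nonzero[OF s] by (simp add: h2_def)
  from L_vec_N[OF assms refl this] show ?thesis
    by (simp only: factor_eq[OF s])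
qed

text \<open>The quadratic 1 + q + q^2 has no real root, and P > 0 excludes c = 0.\<close>

lemma factor_nonzero:
  assumes "s \<in> D"
  shows "factor s \<noteq> 0"
proof -
  have "c \<noteq> 0" using D_facts(2)[OF assms] by (auto simp: P_def)
  moreover have "1 + q * (1 + q) > 0" for q :: real
  proof -
    have "1 + q * (1 + q) = (q + 1/2)\<^sup>2 + 3/4" by (simp add: power2_eq_square algebra_simps)
    then show ?thesis by (simp add: add_nonneg_pos)
  qed
  from this[of "12 * d * s^3"] have "1 + 12 * d * s^3 * (1 + 12 * d * s^3) \<noteq> 0" by simp
  ultimately show ?thesis
    using D_facts(1)[OF assms] h_nonzero[OF assms] by (simp add: factor_def)
qed

section \<open>Smoothness of the hypersurface, its Gauss map and the factor\<close>

lemma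
  shows elementary_h: "elementary U (\<lambda>p. h (p$1))"
    and elementary_n: "elementary U (\<lambda>p. n (p$1))"
proof -
  have s: "p$1 \<in> D" if "p \<in> U" for p using that by (simp add: U_def)
  have lin: "elementary U (\<lambda>p. - 3 * p$1)"
    by (intro elementary.mult elementary.const elementary.coord)
  have "elementary U (\<lambda>p. P (p$1))" "elementary U (\<lambda>p. Q (p$1))"
    unfolding P_def Q_def
    by (intro elementary.add elementary.mult elementary.const elementary.coord elementary_power)+
  then have "elementary U (\<lambda>p. P (p$1) / (- 3 * p$1))" "elementary U (\<lambda>p. Q (p$1) / (- 3 * p$1))"
    by (intro elementary_divide lin; use D_facts[OF s] in force)+
  then show "elementary U (\<lambda>p. h (p$1))" "elementary U (\<lambda>p. n (p$1))"
    unfolding h_def n_def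
    by (intro elementary.mult elementary.const elementary.sqrt; use D_facts[OF s] in \<open>force simp: divide_pos_neg\<close>)+
qed

text \<open>The profile integral enters through the rule \<open>prim\<close>, as an antiderivative
  of the elementary function h / n.\<close>

lemma smooth_X: "smooth_on U X"
proof (rule elementary_smooth_on_vec[OF _ open_U])
  have s: "p$1 \<in> D" if "p \<in> U" for p using that by (simp add: U_def)
  have "elementary U (\<lambda>p. h (p$1) / n (p$1))"
    by (intro elementary_divide elementary_h elementary_n) (use n_pos s in force)
  then have "elementary U (\<lambda>p. profile \<sigma> c d e (p$1))"
    by (rule elementary.prim) (rule deriv_profile[OF s])
  then have "\<forall>i. elementary U (\<lambda>p. X p $ i)"
    unfolding rot_hypersurface_def Let_def forall_4 vector_4
    by (intro conjI elementary.mult elementary.sin elementary.cos elementary_minus elementary.coord)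
  then show "elementary U (\<lambda>p. X p $ i)" for i by blast
qed

lemma smooth_N: "smooth_on U N"
proof (rule elementary_smooth_on_vec[OF _ open_U])
  have "\<forall>i. elementary U (\<lambda>p. vector [n (p$1), - h (p$1) * cos (p$2) * sin (p$3),
      - h (p$1) * sin (p$2), h (p$1) * cos (p$2) * cos (p$3)] $ (i::4))"
    unfolding forall_4 vector_4
    by (intro conjI elementary.mult elementary.sin elementary.cos elementary_minus elementary.coord
        elementary_h elementary_n)
  then have E: "elementary U (\<lambda>p. vector [n (p$1), - h (p$1) * cos (p$2) * sin (p$3),
      - h (p$1) * sin (p$2), h (p$1) * cos (p$2) * cos (p$3)] $ (i::4))" for i
    by blast
  show "elementary U (\<lambda>p. N p $ i)" for i
    by (rule elementary.cong[OF E[of i]]) (simp add: N_eq)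
qed

lemma first_kind: "first_kind_pointwise_1_type 1 U X N"
proof -
  have "elementary U (\<lambda>p. factor (p$1))"
    unfolding factor_def
    by (intro elementary_divide elementary.add elementary.mult elementary_power elementary.const
        elementary.coord elementary_h)
       (use h_nonzero D_facts(1) in \<open>force simp: U_def\<close>)
  then have "smooth_on U (\<lambda>p. factor (p$1))"
    by (rule elementary_smooth_on[OF _ open_U])
  moreover have "\<forall>p\<in>U. factor (p$1) \<noteq> 0"
    using factor_nonzero by (auto simp: U_def)
  ultimately show ?thesis
    unfolding first_kind_pointwise_1_type_def using L_vec_eq by blast
qed

section \<open>Explicit forms of the factor and of L_1 N\<close>

lemma factor_explicit:
  assumes s: "s \<in> D"
  shows "factor s = \<sigma> * (c\<^sup>2 * sqrt 2 * (1 + 12 * d * s^3 * (1 + 12 * d * s^3))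
               / ((- s) powr (9/2) * sqrt (3 * c * (1 + 6 * d * s^3))))"
proof -
  note s0 = D_facts[OF s]
  define a where "a = sqrt (- s)"
  define b where "b = sqrt (c * (1 + 6 * d * s^3))"
  have a: "a > 0" "s = - a\<^sup>2" using s0 by (simp_all add: a_def)
  have Pb: "P s = 2 * (c * (1 + 6 * d * s^3))" by (simp add: P_def algebra_simps)
  have b: "b > 0" using s0(2) unfolding Pb b_def by simp
  have "P s / (- 3 * s) = (2 * (c * (1 + 6 * d * s^3))) / (3 * - s)"
    unfolding Pb by simp
  then have "sqrt (P s / (- 3 * s)) = sqrt 2 * b / (sqrt 3 * a)"
    unfolding a_def b_def by (simp only: real_sqrt_divide real_sqrt_mult)
  then have h: "h s = \<sigma> * (sqrt 2 * b / (sqrt 3 * a))" by (simp add: h_def)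
  have "(- s) powr (9/2) = (- s) powr (4 + 1/2)" by simp
  also have "\<dots> = (- s)^4 * a"
    using s0 unfolding powr_add a_def by (simp add: powr_half_sqrt)
  finally have pw: "(- s) powr (9/2) = s^4 * a" by simp
  have sq: "sqrt (3 * c * (1 + 6 * d * s^3)) = sqrt 3 * b"
    unfolding b_def by (simp add: real_sqrt_mult mult.assoc)
  define K where "K = 1 + 12 * d * s^3 * (1 + 12 * d * s^3)"
  \<comment> \<open>The odd power supplies the minus sign that cancels the one in
    \<open>factor\<close>; a^2 against the \<open>a\<close> in \<open>h\<close> leaves the exponent
    9/2.\<close>
  have s5: "s^5 = - (s^4 * a\<^sup>2)" using a(2) by (simp add: numeral_eq_Suc)
  have "factor s = 2 * c\<^sup>2 * K * \<sigma> * (sqrt 3 * a) / (3 * (s^4 * a\<^sup>2) * (sqrt 2 * b))"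
    unfolding factor_def K_def[symmetric] h s5 using sign by auto
  also have "\<dots> = \<sigma> * (c\<^sup>2 * sqrt 2 * K / (s^4 * a * (sqrt 3 * b)))"
    using a(1) b s0(1) by (simp add: field_simps power2_eq_square)
  finally show ?thesis unfolding pw sq K_def .
qed

text \<open>Pulling \<open>h\<close> out of the Gauss map leaves the time component n / h = 1 / f',
  and \<open>factor\<close> times \<open>h\<close> is a rational function of
  \<open>s\<close>.\<close>

lemma L_vec_explicit:
  assumes U: "(vector [s, t, w] :: real^3) \<in> U"
  shows "L_vec 1 X N N (vector [s, t, w]) =
         (2 * c\<^sup>2 * (1 + 12 * s^3 * d * (1 + 12 * d * s^3)) / (3 * s^5)) *\<^sub>R
           vector [- \<sigma> * (sqrt (6 * s + 4 * c + 24 * c * d * s^3)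
                           / (2 * sqrt (c * (1 + 6 * d * s^3)))),
                   cos t * sin w, sin t, - cos t * cos w]"
proof -
  have s: "s \<in> D" using U by (simp add: U_def)
  note s0 = D_facts[OF s] and hn = h_nonzero[OF s]
  define M where "M = 2 * c\<^sup>2 * (1 + 12 * s^3 * d * (1 + 12 * d * s^3)) / (3 * s^5)"
  have mh: "factor s * h s = - M"
    using hn unfolding factor_def M_def by (simp add: mult_ac)
  have nh: "n s / h s = \<sigma> * (sqrt (Q s) / sqrt (P s))"
  proof -
    have "n s / h s = inverse (h s / n s)" by simp
    then show ?thesis unfolding h_div_n[OF s] using sign by auto
  qed
  have "6 * s + 4 * c + 24 * c * d * s^3 = 2 * Q s" "c * (1 + 6 * d * s^3) = P s / 2"
    by (simp_all add: Q_def P_def algebra_simps)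
  then have "sqrt (6 * s + 4 * c + 24 * c * d * s^3) / (2 * sqrt (c * (1 + 6 * d * s^3))) =
      (sqrt 2 * sqrt (Q s)) / (2 * (sqrt (P s) / sqrt 2))"
    by (simp only: real_sqrt_mult real_sqrt_divide)
  also have "\<dots> = (sqrt 2 * sqrt 2) * sqrt (Q s) / (2 * sqrt (P s))"
    by (simp only: divide_divide_eq_right times_divide_eq_right mult_ac)
  also have "\<dots> = sqrt (Q s) / sqrt (P s)"
    by simp
  finally have r: "\<sigma> * (sqrt (6 * s + 4 * c + 24 * c * d * s^3) / (2 * sqrt (c * (1 + 6 * d * s^3)))) =
      n s / h s"
    using nh by simp
  have mn: "factor s * n s = - M * (n s / h s)"
    unfolding mh[symmetric] using hn by simp
  have ms: "factor s * (h s * x) = - M * x" for x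
    using mh by (simp add: mult.assoc[symmetric])
  show ?thesis
    unfolding L_vec_eq[OF U] N_eq[OF U] M_def[symmetric] mult_minus_left r vector_3
    by (simp add: vec_eq_iff forall_4 mn ms mult.assoc)
qed

end

text \<open>The sign of f' passes to \<open>h\<close>, hence to the factor and to the time component
  in the last formula. The informal expression for the factor is the case \<sigma> = 1, the informal
  time component the case \<sigma> = -1.\<close>

theorem theorem6:
  fixes c10 c11 c12 \<sigma> :: real
    and f :: "real \<Rightarrow> real"
    and \<Gamma> N :: "real^3 \<Rightarrow> real^4"
    and U :: "(real^3) set"
  assumes "\<sigma> = 1 \<or> \<sigma> = -1"
    and "f = profile \<sigma> c10 c11 c12"
    and "\<Gamma> = rot_hypersurface f"
    and "N = rot_gauss_map f"
    and "U = param_domain c10 c11"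
  shows "oriented_hypersurface U \<Gamma> N 1 \<and>
    first_kind_pointwise_1_type 1 U \<Gamma> N \<and>
    (\<forall>s t w. (vector [s, t, w] :: real^3) \<in> U \<longrightarrow>
       L_vec 1 \<Gamma> N N (vector [s, t, w]) =
         (\<sigma> * (c10\<^sup>2 * sqrt 2 * (1 + 12 * c11 * s^3 * (1 + 12 * c11 * s^3))
               / ((- s) powr (9/2) * sqrt (3 * c10 * (1 + 6 * c11 * s^3)))))
           *\<^sub>R N (vector [s, t, w]) \<and>
       L_vec 1 \<Gamma> N N (vector [s, t, w]) =
         (2 * c10\<^sup>2 * (1 + 12 * s^3 * c11 * (1 + 12 * c11 * s^3)) / (3 * s^5)) *\<^sub>R
           vector [- \<sigma> * (sqrt (6 * s + 4 * c10 + 24 * c10 * c11 * s^3)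
                           / (2 * sqrt (c10 * (1 + 6 * c11 * s^3)))),
                   cos t * sin w, sin t, - cos t * cos w])"
proof -
  interpret M: profile_with_constant_a2 \<sigma> c10 c11 c12
    by unfold_locales (rule assms(1))
  have eqs: "\<Gamma> = M.X" "N = M.N" "U = M.U"
    using assms(2-5) by (simp_all add: M.U_eq)
  have "L_vec 1 M.X M.N M.N (vector [s, t, w]) =
      (\<sigma> * (c10\<^sup>2 * sqrt 2 * (1 + 12 * c11 * s^3 * (1 + 12 * c11 * s^3))
               / ((- s) powr (9/2) * sqrt (3 * c10 * (1 + 6 * c11 * s^3)))))
           *\<^sub>R M.N (vector [s, t, w])"
    if U: "(vector [s, t, w] :: real^3) \<in> M.U" for s t w
  proof -
    have "s \<in> profile_domain c10 c11" using U by (simp add: M.U_def)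
    from M.factor_explicit[OF this] show ?thesis
      using M.L_vec_eq[OF U] by simp
  qed
  then show ?thesis
    unfolding eqs
    using M.oriented_hypersurface_rotation[OF M.smooth_X M.smooth_N] M.first_kind M.L_vec_explicit by blast
qed

end
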